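(* Let $(K,\mathcal{L})$ be a $C$-minimal valued field, $W$ a definable set, and $f\colon X\subseteq W\times K\to K$ a definable family of local $C$-isomorphisms. Then there are a definable family of functions $h\colon Y\subseteq X\times \Gamma_K\to \Gamma_K$ and a definable subset $F\subseteq X$ such that, for all $w\in W$, the set $F_w$ is finite and $f_w|(X_w\setminus F_w)$ locally factorizes over $\Gamma$ through $h_{w}$.
   Context: Valued fields $(K,v)$ are non-trivially valued; $\Gamma_K$ is the value group. Closed balls are $B(a,\gamma)=\{x\in K: v(x-a)\geq\gamma\}$ for $a \in K$, $\gamma\in\Gamma_K\cup\{+\infty\}$; open balls are $B^\circ(a,\gamma)=\{x\in K: v(x-a)>\gamma\}$ for $a\in K$, $\gamma\in\Gamma_K\cup\{-\infty\}$ (so points are closed balls and $K$ is an open ball). A ball is a closed or an open ball. $\mathcal{L}_{div}=(+,-,\cdot,0,1,\mathrm{div})$ is the language of valued fields, with $\mathrm{div}(x,y)$ interpreted as $v(x)\leq v(y)$. Let $K$ be an algebraically closed valued field and $(K,\mathcal{L})$ an expansion of $(K,\mathcal{L}_{div})$ ($\mathcal{L}\supseteq\mathcal{L}_{div}$). $(K,\mathcal{L})$ is $C$-minimal (a "$C$-minimal valued field") if for every structure $(K',\mathcal{L})$ elementarily equivalent to it, every $\mathcal{L}$-definable subset of $K'$ is a boolean combination of balls. "Definable" means $\mathcal{L}$-definable with parameters; for subsets of (products involving) $\Gamma_K$ it means interpretable. A definable family $X\subseteq W\times K$ is a definable set whose projection to $W$ is all of $W$; $X_w=\{x: (w,x)\in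 X\}$ (and $F_w=\{x:(w,x)\in F\}$ for $F\subseteq X$). A definable family of functions is a definable function $f\colon X\subseteq W\times K\to K$, with fibers $f_w\colon X_w\to K$, $f_w(x)=f(w,x)$. The $C$-relation on $K$ is $C(x,y,z)\Leftrightarrow v(x-y)=v(x-z)<v(y-z)$. For an open ball $B\subseteq K$, a function $g\colon B\to K$ is a $C$-isomorphism if $g(B)$ is an open ball and for all $x,y,z\in B$, $C(x,y,z)\Leftrightarrow C(g(x),g(y),g(z))$. A function $g\colon Z\subseteq K\to K$ is a local $C$-isomorphism if every $x\in Z$ lies in an open ball $B\subseteq Z$ such that $g|B$ is a $C$-isomorphism. $f$ is a family of local $C$-isomorphisms if each $f_w$ is a local $C$-isomorphism. A function $g\colon Z\subseteq K\to K$ factorizes over $\Gamma$ through a (possibly partial) function $h\colon\Gamma_K\to\Gamma_K$ if $v(g(x)-g(y))=h(v(x-y))$ for all distinct $x,y\in Z$. For a (partial) function $h$ of $(x,\gamma)\in Z\times \Gamma_K$ with values in $\Gamma_K$, with $h_x(\gamma):=h(x,\gamma)$, $g$ locally factorizes over $\Gamma$ through $h$ if for every $x\in Z$ there is an open ball $B_x\subseteq Z$ containing $x$ such that $g|B_x$ factorizes over $\Gamma$ through $h_x$. For $h\colon Y\subseteq X\times\Gamma_K\to\Gamma_K$ with $X\subseteq W\times K$, $h_w$ denotes $(x,\gamma)\mapsto h(w,x,\gamma)$. *)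

theory Defs
  imports "HOL-Library.Extended" "HOL-Computational_Algebra.Polynomial"
begin

section \<open>First-order logic\<close>

text \<open>
  A signature assigns an arity to each of its symbols. The symbols of the signature are those in
  the domain of the two maps, so the types of symbols may contain symbols that are not used.
\<close>

record ('f, 'r) signature =
  fun_arity :: "'f \<Rightarrow> nat option"
  rel_arity :: "'r \<Rightarrow> nat option"

datatype 'f fo_term = Var nat | App 'f "'f fo_term list"

datatype ('f, 'r) fo_formula =
    Equal "'f fo_term" "'f fo_term"
  | Atom 'r "'f fo_term list"
  | Neg "('f, 'r) fo_formula"
  | Conj "('f, 'r) fo_formula" "('f, 'r) fo_formula"
  | Exists nat "('f, 'r) fo_formula"

fun wf_term :: "('f, 'r) signature \<Rightarrow> 'f fo_term \<Rightarrow> bool" where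
  "wf_term L (Var i) = True"
| "wf_term L (App s ts) = (fun_arity L s = Some (length ts) \<and> (\<forall>t\<in>set ts. wf_term L t))"

fun wf_formula :: "('f, 'r) signature \<Rightarrow> ('f, 'r) fo_formula \<Rightarrow> bool" where
  "wf_formula L (Equal s t) = (wf_term L s \<and> wf_term L t)"
| "wf_formula L (Atom r ts) = (rel_arity L r = Some (length ts) \<and> (\<forall>t\<in>set ts. wf_term L t))"
| "wf_formula L (Neg \<phi>) = wf_formula L \<phi>"
| "wf_formula L (Conj \<phi> \<psi>) = (wf_formula L \<phi> \<and> wf_formula L \<psi>)"
| "wf_formula L (Exists i \<phi>) = wf_formula L \<phi>"

fun term_vars :: "'f fo_term \<Rightarrow> nat set" where
  "term_vars (Var i) = {i}"
| "term_vars (App s ts) = (\<Union>t\<in>set ts. term_vars t)"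

fun free_vars :: "('f, 'r) fo_formula \<Rightarrow> nat set" where
  "free_vars (Equal s t) = term_vars s \<union> term_vars t"
| "free_vars (Atom r ts) = (\<Union>t\<in>set ts. term_vars t)"
| "free_vars (Neg \<phi>) = free_vars \<phi>"
| "free_vars (Conj \<phi> \<psi>) = free_vars \<phi> \<union> free_vars \<psi>"
| "free_vars (Exists i \<phi>) = free_vars \<phi> - {i}"

record ('f, 'r, 'u) fo_structure =
  univ :: "'u set"
  fun_int :: "'f \<Rightarrow> 'u list \<Rightarrow> 'u"
  rel_int :: "'r \<Rightarrow> 'u list \<Rightarrow> bool"

definition is_structure :: "('f, 'r) signature \<Rightarrow> ('f, 'r, 'u) fo_structure \<Rightarrow> bool" where
  "is_structure L M \<longleftrightarrow> univ M \<noteq> {} \<and>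
     (\<forall>s k xs. fun_arity L s = Some k \<longrightarrow> length xs = k \<longrightarrow> set xs \<subseteq> univ M \<longrightarrow> fun_int M s xs \<in> univ M)"

fun eval_term :: "('f, 'r, 'u) fo_structure \<Rightarrow> (nat \<Rightarrow> 'u) \<Rightarrow> 'f fo_term \<Rightarrow> 'u" where
  "eval_term M e (Var i) = e i"
| "eval_term M e (App s ts) = fun_int M s (map (eval_term M e) ts)"

fun sat :: "('f, 'r, 'u) fo_structure \<Rightarrow> (nat \<Rightarrow> 'u) \<Rightarrow> ('f, 'r) fo_formula \<Rightarrow> bool" where
  "sat M e (Equal s t) \<longleftrightarrow> eval_term M e s = eval_term M e t"
| "sat M e (Atom r ts) \<longleftrightarrow> rel_int M r (map (eval_term M e) ts)"
| "sat M e (Neg \<phi>) \<longleftrightarrow> \<not> sat M e \<phi>"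
| "sat M e (Conj \<phi> \<psi>) \<longleftrightarrow> sat M e \<phi> \<and> sat M e \<psi>"
| "sat M e (Exists i \<phi>) \<longleftrightarrow> (\<exists>a\<in>univ M. sat M (e(i := a)) \<phi>)"

definition models :: "('f, 'r, 'u) fo_structure \<Rightarrow> ('f, 'r) fo_formula \<Rightarrow> bool" where
  "models M \<phi> \<longleftrightarrow> (\<forall>e. range e \<subseteq> univ M \<longrightarrow> sat M e \<phi>)"

definition elementarily_equivalent ::
  "('f, 'r) signature \<Rightarrow> ('f, 'r, 'u) fo_structure \<Rightarrow> ('f, 'r, 'w) fo_structure \<Rightarrow> bool" where
  "elementarily_equivalent L M N \<longleftrightarrow>
     (\<forall>\<phi>. wf_formula L \<phi> \<and> free_vars \<phi> = {} \<longrightarrow> (models M \<phi> \<longleftrightarrow> models N \<phi>))"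

text \<open>
  Definability with parameters of a set of \<open>n\<close>-tuples: the variables below \<open>n\<close> are the coordinates
  of the tuple, all other variables are assigned parameters by \<open>e\<close>.
\<close>

definition definable_set ::
  "('f, 'r) signature \<Rightarrow> ('f, 'r, 'u) fo_structure \<Rightarrow> nat \<Rightarrow> 'u list set \<Rightarrow> bool" where
  "definable_set L M n S \<longleftrightarrow>
     (\<exists>\<phi> e. wf_formula L \<phi> \<and> range e \<subseteq> univ M \<and>
        S = {xs. length xs = n \<and> set xs \<subseteq> univ M \<and> sat M (\<lambda>i. if i < n then xs ! i else e i) \<phi>})"


section \<open>Valued fields and their expansions\<close>

text \<open>
  The value group is the whole type \<open>'g\<close>: the valuation is required to be onto. The value
  \<open>-\<infinity>\<close> is never taken; it only serves as a radius of open balls.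
\<close>

definition nontrivial_valuation ::
  "('k::field \<Rightarrow> 'g::linordered_ab_group_add extended) \<Rightarrow> bool" where
  "nontrivial_valuation v \<longleftrightarrow>
     (\<forall>x. v x = \<infinity> \<longleftrightarrow> x = 0) \<and>
     (\<forall>x. v x \<noteq> -\<infinity>) \<and>
     (\<forall>x y. v (x * y) = v x + v y) \<and>
     (\<forall>x y. min (v x) (v y) \<le> v (x + y)) \<and>
     (\<forall>\<gamma>. \<exists>x. v x = Fin \<gamma>) \<and>
     (\<exists>x. x \<noteq> 0 \<and> v x \<noteq> 0)"

definition closed_balls :: "('k::field \<Rightarrow> 'g::linordered_ab_group_add extended) \<Rightarrow> 'k set set" where
  "closed_balls v = {{x. v (x - a) \<ge> \<gamma>} | a \<gamma>. \<gamma> \<noteq> -\<infinity>}"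

definition open_balls :: "('k::field \<Rightarrow> 'g::linordered_ab_group_add extended) \<Rightarrow> 'k set set" where
  "open_balls v = {{x. v (x - a) > \<gamma>} | a \<gamma>. \<gamma> \<noteq> \<infinity>}"

datatype 'f vf_fun = Plus | Minus | Times | Zero | One | ExtraFun 'f
datatype 'r vf_rel = Div | ExtraRel 'r

definition L_div :: "('f vf_fun, 'r vf_rel) signature" where
  "L_div = \<lparr>fun_arity = [Plus \<mapsto> 2, Minus \<mapsto> 2, Times \<mapsto> 2, Zero \<mapsto> 0, One \<mapsto> 0],
            rel_arity = [Div \<mapsto> 2]\<rparr>"

definition expansion_of_valued_field ::
  "('k::field \<Rightarrow> 'g::linordered_ab_group_add extended) \<Rightarrow> ('f vf_fun, 'r vf_rel) signature \<Rightarrow>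
    ('f vf_fun, 'r vf_rel, 'k) fo_structure \<Rightarrow> bool" where
  "expansion_of_valued_field v L M \<longleftrightarrow>
     nontrivial_valuation v \<and>
     fun_arity (L_div :: ('f vf_fun, 'r vf_rel) signature) \<subseteq>\<^sub>m fun_arity L \<and>
     rel_arity (L_div :: ('f vf_fun, 'r vf_rel) signature) \<subseteq>\<^sub>m rel_arity L \<and>
     is_structure L M \<and>
     univ M = UNIV \<and>
     (\<forall>x y. fun_int M Plus [x, y] = x + y) \<and>
     (\<forall>x y. fun_int M Minus [x, y] = x - y) \<and>
     (\<forall>x y. fun_int M Times [x, y] = x * y) \<and>
     fun_int M Zero [] = 0 \<and>
     fun_int M One [] = 1 \<and>
     (\<forall>x y. rel_int M Div [x, y] \<longleftrightarrow> v x \<le> v y)"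


section \<open>$C$-minimality\<close>

text \<open>
  Balls of an arbitrary structure elementarily equivalent to an expansion of a valued field, where
  the valuation is only given by \<open>Div\<close>. Each element of the value group or \<open>\<infinity>\<close> is the value of
  some element \<open>c\<close>, with \<open>c = 0\<close> for \<open>\<infinity>\<close>; for open balls, the radius \<open>-\<infinity>\<close> gives the universe.
\<close>

definition structure_closed_balls :: "('f vf_fun, 'r vf_rel, 'u) fo_structure \<Rightarrow> 'u set set" where
  "structure_closed_balls N =
     {{x \<in> univ N. rel_int N Div [c, fun_int N Minus [x, a]]} | a c. a \<in> univ N \<and> c \<in> univ N}"

definition structure_open_balls :: "('f vf_fun, 'r vf_rel, 'u) fo_structure \<Rightarrow> 'u set set" where
  "structure_open_balls N =
     insert (univ N)
       {{x \<in> univ N. \<not> rel_int N Div [fun_int N Minus [x, a], c]} | a c.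
          a \<in> univ N \<and> c \<in> univ N \<and> c \<noteq> fun_int N Zero []}"

lemma structure_closed_balls_eq:
  assumes "expansion_of_valued_field v L M"
  shows "structure_closed_balls M = closed_balls v"
proof -
  have val: "v 0 = \<infinity>" "\<And>x. v x \<noteq> -\<infinity>" "\<And>\<gamma>. \<exists>x. v x = Fin \<gamma>"
    using assms by (auto simp: expansion_of_valued_field_def nontrivial_valuation_def)
  have "(\<exists>c. v c = \<gamma>) \<longleftrightarrow> \<gamma> \<noteq> -\<infinity>" for \<gamma>
    using val by (cases \<gamma>) auto
  then show ?thesis
    using assms
    unfolding structure_closed_balls_def closed_balls_def expansion_of_valued_field_def
    by auto metis+
qed

lemma structure_open_balls_eq:
  assumes "expansion_of_valued_field v L M"
  shows "structure_open_balls M = open_balls v"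
proof -
  have M: "univ M = UNIV" "\<And>x y. fun_int M Minus [x, y] = x - y" "fun_int M Zero [] = 0"
    "\<And>x y. rel_int M Div [x, y] \<longleftrightarrow> v x \<le> v y"
    using assms by (auto simp: expansion_of_valued_field_def)
  have val: "\<And>x. v x = \<infinity> \<longleftrightarrow> x = 0" "\<And>x. v x \<noteq> -\<infinity>" "\<And>\<gamma>. \<exists>x. v x = Fin \<gamma>"
    using assms by (auto simp: expansion_of_valued_field_def nontrivial_valuation_def)
  have gt: "-\<infinity> < v x" for x
    using val(2)[of x] by (cases "v x") auto
  have "structure_open_balls M = insert UNIV {{x. v c < v (x - a)} | a c. c \<noteq> 0}"
    by (simp add: structure_open_balls_def M not_le)
  also have "\<dots> = open_balls v"
  proof (intro equalityI subsetI)
    fix B assume "B \<in> insert UNIV {{x. v c < v (x - a)} | a c. c \<noteq> 0}"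
    then consider "B = UNIV" | a c where "B = {x. v c < v (x - a)}" "c \<noteq> 0" by auto
    then show "B \<in> open_balls v"
    proof cases
      case 1
      then have "B = {x. v (x - 0) > -\<infinity>}" using gt by auto
      then show ?thesis unfolding open_balls_def by blast
    next
      case 2
      then show ?thesis using val(1) unfolding open_balls_def by blast
    qed
  next
    fix B assume "B \<in> open_balls v"
    then obtain a \<gamma> where B: "B = {x. v (x - a) > \<gamma>}" "\<gamma> \<noteq> \<infinity>"
      unfolding open_balls_def by auto
    show "B \<in> insert UNIV {{x. v c < v (x - a)} | a c. c \<noteq> 0}"
    proof (cases \<gamma>)
      case (Fin \<delta>)
      obtain c where "v c = Fin \<delta>" using val(3) by blast
      with val(1)[of c] B Fin show ?thesis by auto
    qed (use B gt in auto)
  qed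
  finally show ?thesis .
qed

inductive_set boolean_combinations :: "'u set \<Rightarrow> 'u set set \<Rightarrow> 'u set set"
  for A :: "'u set" and \<B> :: "'u set set" where
  base: "B \<in> \<B> \<Longrightarrow> B \<in> boolean_combinations A \<B>"
| compl: "B \<in> boolean_combinations A \<B> \<Longrightarrow> A - B \<in> boolean_combinations A \<B>"
| union: "B \<in> boolean_combinations A \<B> \<Longrightarrow> C \<in> boolean_combinations A \<B> \<Longrightarrow>
    B \<union> C \<in> boolean_combinations A \<B>"

text \<open>
  HOL cannot quantify over structures of all types; here they range over the structures whose
  universe is a subset of the type \<open>nat \<Rightarrow> 'k\<close>. This is no restriction, whatever the size of the
  language. Suppose that \<open>\<phi>(x, a)\<close> does not define a boolean combination of balls in some structure
  elementarily equivalent to \<open>M\<close>. For every \<open>k\<close>, a sentence true there, and hence in \<open>M\<close>, says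
  that some instance \<open>\<phi>(x, y)\<close> is not a boolean combination of at most \<open>k\<close> balls. Choosing such
  a parameter in \<open>M\<close> for each \<open>k\<close> gives an element of a nonprincipal ultrapower of \<open>M\<close> over the
  natural numbers for which \<open>\<phi>\<close> does not define a boolean combination of balls, and a system of
  representatives makes this ultrapower a structure on a subset of \<open>nat \<Rightarrow> 'k\<close>.
\<close>

definition C_minimal ::
  "('f vf_fun, 'r vf_rel) signature \<Rightarrow> ('f vf_fun, 'r vf_rel, 'k) fo_structure \<Rightarrow> bool" where
  "C_minimal L M \<longleftrightarrow>
     (\<forall>N :: ('f vf_fun, 'r vf_rel, nat \<Rightarrow> 'k) fo_structure.
        is_structure L N \<and> elementarily_equivalent L M N \<longrightarrow>
        (\<forall>S. definable_set L N 1 ((\<lambda>x. [x]) ` S) \<longrightarrow>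
           S \<in> boolean_combinations (univ N) (structure_closed_balls N \<union> structure_open_balls N)))"


section \<open>Definable sets and families\<close>

text \<open>
  Subsets of $K^n \times \Gamma_K^m$ are sets of pairs of lists. Such a set is definable, that is,
  interpretable, iff its preimage in $K^n \times (K^\times)^m$ under the valuation is.
\<close>

type_synonym ('k, 'g) point = "'k list \<times> 'g list"

definition definable ::
  "('k \<Rightarrow> 'g extended) \<Rightarrow> ('f, 'r) signature \<Rightarrow> ('f, 'r, 'k) fo_structure \<Rightarrow> nat \<Rightarrow> nat \<Rightarrow>
    ('k, 'g) point set \<Rightarrow> bool" where
  "definable v L M n m S \<longleftrightarrow>
     (\<forall>(a, g) \<in> S. length a = n \<and> length g = m) \<and>
     definable_set L M (n + m)
       {a @ b | a b g. (a, g) \<in> S \<and> list_all2 (\<lambda>y \<gamma>. v y = Fin \<gamma>) b g}"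

text \<open>Identification of $(K^n \times \Gamma_K^m) \times K$ with $K^{n+1} \times \Gamma_K^m$, and
  of $(K^n \times \Gamma_K^m) \times \Gamma_K$ with $K^n \times \Gamma_K^{m+1}$.\<close>

fun add_K :: "('k, 'g) point \<Rightarrow> 'k \<Rightarrow> ('k, 'g) point" where
  "add_K (a, g) x = (a @ [x], g)"

fun add_VG :: "('k, 'g) point \<Rightarrow> 'g \<Rightarrow> ('k, 'g) point" where
  "add_VG (a, g) \<gamma> = (a, g @ [\<gamma>])"

definition definable_subset_family ::
  "('k \<Rightarrow> 'g extended) \<Rightarrow> ('f, 'r) signature \<Rightarrow> ('f, 'r, 'k) fo_structure \<Rightarrow> nat \<Rightarrow> nat \<Rightarrow>
    (('k, 'g) point \<times> 'k) set \<Rightarrow> bool" where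
  "definable_subset_family v L M n m X \<longleftrightarrow> definable v L M (n + 1) m {add_K w x | w x. (w, x) \<in> X}"

definition definable_family ::
  "('k \<Rightarrow> 'g extended) \<Rightarrow> ('f, 'r) signature \<Rightarrow> ('f, 'r, 'k) fo_structure \<Rightarrow> nat \<Rightarrow> nat \<Rightarrow>
    ('k, 'g) point set \<Rightarrow> (('k, 'g) point \<times> 'k) set \<Rightarrow> bool" where
  "definable_family v L M n m W X \<longleftrightarrow> definable_subset_family v L M n m X \<and> fst ` X = W"

text \<open>A function on \<open>X\<close> is represented by a total function, of which only the values on \<open>X\<close> matter.\<close>

definition definable_family_of_functions ::
  "('k \<Rightarrow> 'g extended) \<Rightarrow> ('f, 'r) signature \<Rightarrow> ('f, 'r, 'k) fo_structure \<Rightarrow> nat \<Rightarrow> nat \<Rightarrow>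
    ('k, 'g) point set \<Rightarrow> (('k, 'g) point \<times> 'k) set \<Rightarrow> (('k, 'g) point \<Rightarrow> 'k \<Rightarrow> 'k) \<Rightarrow> bool" where
  "definable_family_of_functions v L M n m W X f \<longleftrightarrow>
     definable_family v L M n m W X \<and>
     definable v L M (n + 2) m {add_K (add_K w x) (f w x) | w x. (w, x) \<in> X}"

text \<open>
  Definable families of functions $h \colon Y \subseteq X \times \Gamma_K \to \Gamma_K$; here \<open>h\<close> is a
  partial function with domain \<open>Y\<close>, since being undefined is relevant for factorizations.
\<close>

definition definable_family_of_VG_functions ::
  "('k \<Rightarrow> 'g extended) \<Rightarrow> ('f, 'r) signature \<Rightarrow> ('f, 'r, 'k) fo_structure \<Rightarrow> nat \<Rightarrow> nat \<Rightarrow>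
    (('k, 'g) point \<times> 'k) set \<Rightarrow> ((('k, 'g) point \<times> 'k) \<times> 'g) set \<Rightarrow>
    (('k, 'g) point \<Rightarrow> 'k \<Rightarrow> 'g \<Rightarrow> 'g option) \<Rightarrow> bool" where
  "definable_family_of_VG_functions v L M n m X Y h \<longleftrightarrow>
     Y = {((w, x), \<gamma>) | w x \<gamma>. h w x \<gamma> \<noteq> None} \<and>
     fst ` Y = X \<and>
     definable v L M (n + 1) (m + 1) {add_VG (add_K w x) \<gamma> | w x \<gamma>. ((w, x), \<gamma>) \<in> Y} \<and>
     definable v L M (n + 1) (m + 2)
       {add_VG (add_VG (add_K w x) \<gamma>) \<delta> | w x \<gamma> \<delta>. h w x \<gamma> = Some \<delta>}"


section \<open>Local $C$-isomorphisms and factorization over the value group\<close>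

definition C_rel ::
  "('k::field \<Rightarrow> 'g::linordered_ab_group_add extended) \<Rightarrow> 'k \<Rightarrow> 'k \<Rightarrow> 'k \<Rightarrow> bool" where
  "C_rel v x y z \<longleftrightarrow> v (x - y) = v (x - z) \<and> v (x - z) < v (y - z)"

definition C_isomorphism ::
  "('k::field \<Rightarrow> 'g::linordered_ab_group_add extended) \<Rightarrow> 'k set \<Rightarrow> ('k \<Rightarrow> 'k) \<Rightarrow> bool" where
  "C_isomorphism v B g \<longleftrightarrow>
     B \<in> open_balls v \<and> g ` B \<in> open_balls v \<and>
     (\<forall>x\<in>B. \<forall>y\<in>B. \<forall>z\<in>B. C_rel v x y z \<longleftrightarrow> C_rel v (g x) (g y) (g z))"

definition local_C_isomorphism ::
  "('k::field \<Rightarrow> 'g::linordered_ab_group_add extended) \<Rightarrow> 'k set \<Rightarrow> ('k \<Rightarrow> 'k) \<Rightarrow> bool" where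
  "local_C_isomorphism v Z g \<longleftrightarrow>
     (\<forall>x\<in>Z. \<exists>B\<in>open_balls v. x \<in> B \<and> B \<subseteq> Z \<and> C_isomorphism v B g)"

definition factorizes ::
  "('k::field \<Rightarrow> 'g::linordered_ab_group_add extended) \<Rightarrow> 'k set \<Rightarrow> ('k \<Rightarrow> 'k) \<Rightarrow>
    ('g \<Rightarrow> 'g option) \<Rightarrow> bool" where
  "factorizes v Z g h \<longleftrightarrow>
     (\<forall>x\<in>Z. \<forall>y\<in>Z. x \<noteq> y \<longrightarrow>
        (\<exists>\<gamma> \<delta>. v (x - y) = Fin \<gamma> \<and> h \<gamma> = Some \<delta> \<and> v (g x - g y) = Fin \<delta>))"

definition locally_factorizes ::
  "('k::field \<Rightarrow> 'g::linordered_ab_group_add extended) \<Rightarrow> 'k set \<Rightarrow> ('k \<Rightarrow> 'k) \<Rightarrow>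
    ('k \<Rightarrow> 'g \<Rightarrow> 'g option) \<Rightarrow> bool" where
  "locally_factorizes v Z g h \<longleftrightarrow>
     (\<forall>x\<in>Z. \<exists>B\<in>open_balls v. x \<in> B \<and> B \<subseteq> Z \<and> factorizes v B g (h x))"

end

theory Submission
  imports Defs
begin

text \<open>
  Fix \<open>w\<close> and write \<open>g\<close> for \<open>f\<^sub>w\<close>. On a ball where \<open>g\<close> is a $C$-isomorphism, \<open>v (g x - g y)\<close> depends
  only on \<open>x\<close> and \<open>v (x - y)\<close>, which defines a function \<open>h\<^sub>x\<close> from values to values. Let \<open>F\<^sub>w\<close> be the set of
  points around which \<open>h\<^sub>x\<close> is not locally independent of \<open>x\<close>. If \<open>F\<^sub>w\<close> is infinite, it contains a closed
  ball \<open>D\<close> of some radius \<open>\<beta>\<close>. Compare the functions \<open>h\<^sub>x\<close>, for \<open>x\<close> in \<open>D\<close>, lexicographically on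
  the values above \<open>\<beta>\<close>: since a boolean combination of balls cannot alternate along a sequence of strictly
  decreasing values, this is a definable total preorder on \<open>D\<close>.

  By $C$-minimality and compactness there is a bound \<open>j\<close> such that each initial segment, final segment and
  equivalence class of the preorder meets at most \<open>j\<close> of the infinitely many cones (maximal open subballs) of
  \<open>D\<close>, or misses at most \<open>j\<close> of them. The union of a chain of sets each meeting at most \<open>j\<close> cones meets at
  most \<open>j\<close> cones, so if no class were cofinite, then the points with few predecessors and those with
  few successors would cover \<open>D\<close> by finitely many cones. Hence one class contains a whole cone. On that cone
  \<open>g\<close> factorizes over the value group, contradicting the choice of \<open>F\<^sub>w\<close>.
\<close>

section \<open>Ultrapowers\<close>

definition ultra :: "'a filter \<Rightarrow> bool" where
  "ultra U \<longleftrightarrow> U \<noteq> bot \<and> (\<forall>P. eventually P U \<or> eventually (\<lambda>x. \<not> P x) U)"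

lemma ultra_not_iff:
  assumes "ultra U"
  shows "eventually (\<lambda>x. \<not> P x) U \<longleftrightarrow> \<not> eventually P U"
proof
  assume *: "eventually (\<lambda>x. \<not> P x) U"
  show "\<not> eventually P U"
  proof
    assume "eventually P U"
    with * have "eventually (\<lambda>_. False) U"
      by eventually_elim simp
    then show False
      using assms by (simp add: ultra_def)
  qed
qed (use assms in \<open>auto simp: ultra_def\<close>)

lemma ultra_disj_iff:
  "ultra U \<Longrightarrow> eventually (\<lambda>x. P x \<or> Q x) U \<longleftrightarrow> eventually P U \<or> eventually Q U"
  using ultra_not_iff[of U "\<lambda>x. P x \<or> Q x"] ultra_not_iff[of U P] ultra_not_iff[of U Q]
  by (auto simp: eventually_conj_iff)

lemma ultra_iff_iff:
  assumes "ultra U"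
  shows "eventually (\<lambda>x. P x \<longleftrightarrow> Q x) U \<longleftrightarrow> (eventually P U \<longleftrightarrow> eventually Q U)"
proof -
  have "eventually (\<lambda>x. P x \<longleftrightarrow> Q x) U \<longleftrightarrow> eventually (\<lambda>x. (P x \<and> Q x) \<or> (\<not> P x \<and> \<not> Q x)) U"
    by (rule arg_cong[where f = "\<lambda>R. eventually R U"]) blast
  also have "\<dots> \<longleftrightarrow> (eventually P U \<and> eventually Q U) \<or> (\<not> eventually P U \<and> \<not> eventually Q U)"
    by (simp only: ultra_disj_iff[OF assms] eventually_conj_iff ultra_not_iff[OF assms])
  also have "\<dots> \<longleftrightarrow> (eventually P U \<longleftrightarrow> eventually Q U)"
    by blast
  finally show ?thesis .
qed

text \<open>Zorn's lemma for the reversed order on the proper filters below \<open>F\<close>. A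
  chain is directed, so \<open>False\<close> is eventual in its infimum only if it is in a member;
  hence the infimum is proper. A minimal proper filter \<open>U\<close> decides every
  \<open>P\<close>: unless \<open>P\<close> is eventual, meeting \<open>U\<close> with the principal
  filter of \<open>\<not> P\<close> leaves a proper filter, which equals \<open>U\<close>.\<close>

lemma ex_ultra_le:
  fixes F :: "'a filter"
  assumes "F \<noteq> bot"
  shows "\<exists>U\<le>F. ultra U"
proof -
  let ?A = "{G. G \<noteq> bot \<and> G \<le> F}"
  let ?P = "\<lambda>G H :: 'a filter. H \<le> G"
  have "\<exists>U\<in>?A. \<forall>G\<in>?A. G \<le> U \<longrightarrow> G = U"
  proof (rule predicate_Zorn)
    show "partial_order_on ?A (relation_of ?P ?A)"
      by (intro partial_order_on_relation_ofI) auto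
  next
    fix C assume "C \<in> Chains (relation_of ?P ?A)"
    then have C: "C \<subseteq> ?A" "\<And>G H. G \<in> C \<Longrightarrow> H \<in> C \<Longrightarrow> G \<le> H \<or> H \<le> G"
      unfolding Chains_def relation_of_def by blast+
    show "\<exists>u\<in>?A. \<forall>G\<in>C. u \<le> G"
    proof (cases "C = {}")
      case False
      have "eventually (\<lambda>_. False) (Inf C) \<longleftrightarrow> (\<exists>G\<in>C. eventually (\<lambda>_. False) G)"
      proof (rule eventually_Inf_base[OF False])
        show "\<exists>x\<in>C. x \<le> inf G H" if "G \<in> C" "H \<in> C" for G H
          using C(2)[OF that] that by (auto intro: inf_greatest)
      qed
      then have "Inf C \<noteq> bot"
        using C(1) by (auto simp: trivial_limit_def)
      moreover have "Inf C \<le> F"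
        using False C(1) by (metis (no_types, lifting) Inf_lower2 ex_in_conv mem_Collect_eq subsetD)
      ultimately show ?thesis
        by (auto intro: Inf_lower)
    qed (use assms in auto)
  qed
  then obtain U where U: "U \<noteq> bot" "U \<le> F" "\<And>G. G \<noteq> bot \<Longrightarrow> G \<le> U \<Longrightarrow> G = U"
    by (auto intro: order_trans)
  have "eventually (\<lambda>x. \<not> P x) U" if "\<not> eventually P U" for P
  proof -
    have "inf U (principal {x. \<not> P x}) \<noteq> bot"
      using that by (simp add: trivial_limit_def eventually_inf_principal)
    then have "inf U (principal {x. \<not> P x}) = U"
      using U(3) by simp
    moreover have "eventually (\<lambda>x. \<not> P x) (inf U (principal {x. \<not> P x}))"
      by (simp add: eventually_inf_principal)
    ultimately show ?thesis
      by simp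
  qed
  then show ?thesis
    using U(1,2) unfolding ultra_def by blast
qed

text \<open>One representative for each class of functions modulo \<open>U\<close>. The quotient
  thus becomes a subset of the type of functions; for the index type \<open>nat\<close> this is the
  kind of universe over which \<open>C_minimal\<close> quantifies.\<close>

definition urep :: "'i filter \<Rightarrow> ('i \<Rightarrow> 'u) \<Rightarrow> 'i \<Rightarrow> 'u" where
  "urep U x = (SOME y. eventually (\<lambda>k. y k = x k) U)"

lemma eventually_urep: "eventually (\<lambda>k. urep U x k = x k) U"
  unfolding urep_def by (rule someI[of _ x]) simp

lemma urep_cong:
  assumes "eventually (\<lambda>k. x k = y k) U"
  shows "urep U x = urep U y"
proof -
  have "eventually (\<lambda>k. z k = x k) U \<longleftrightarrow> eventually (\<lambda>k. z k = y k) U" for z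
    using assms by (auto elim: eventually_elim2)
  then show ?thesis
    by (simp add: urep_def)
qed

lemma urep_eq_iff:
  fixes x y :: "'a \<Rightarrow> 'b"
  assumes "x \<in> range (urep U)" "y \<in> range (urep U)"
  shows "x = y \<longleftrightarrow> eventually (\<lambda>k. x k = y k) U"
proof -
  have "urep U (urep U z) = urep U z" for z :: "'a \<Rightarrow> 'b"
    by (rule urep_cong[OF eventually_urep])
  with assms have "urep U x = x" "urep U y = y"
    by auto
  then show ?thesis
    using urep_cong[of x y U] by (cases "x = y") auto
qed

section \<open>The ultrapower and the theorem of Los\<close>

definition ultrapower ::
  "'i filter \<Rightarrow> ('f, 'r, 'u) fo_structure \<Rightarrow> ('f, 'r, 'i \<Rightarrow> 'u) fo_structure" where
  "ultrapower U M = \<lparr>univ = range (urep U),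
     fun_int = (\<lambda>s xs. urep U (\<lambda>k. fun_int M s (map (\<lambda>x. x k) xs))),
     rel_int = (\<lambda>r xs. eventually (\<lambda>k. rel_int M r (map (\<lambda>x. x k) xs)) U)\<rparr>"

lemma ultrapower_simps [simp]:
  "univ (ultrapower U M) = range (urep U)"
  "fun_int (ultrapower U M) s xs = urep U (\<lambda>k. fun_int M s (map (\<lambda>x. x k) xs))"
  "rel_int (ultrapower U M) r xs \<longleftrightarrow> eventually (\<lambda>k. rel_int M r (map (\<lambda>x. x k) xs)) U"
  by (simp_all add: ultrapower_def)

lemma is_structure_ultrapower: "is_structure L (ultrapower U M)"
  by (auto simp: is_structure_def)

lemma eval_term_ultrapower:
  "eventually (\<lambda>k. eval_term (ultrapower U M) e t k = eval_term M (\<lambda>i. e i k) t) U"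
proof (induction t)
  case (App s ts)
  let ?N = "ultrapower U M"
  have "eventually (\<lambda>k. \<forall>t\<in>set ts. eval_term ?N e t k = eval_term M (\<lambda>i. e i k) t) U"
    using App by (intro eventually_ball_finite) auto
  then have "eventually (\<lambda>k. map (\<lambda>t. eval_term ?N e t k) ts = map (eval_term M (\<lambda>i. e i k)) ts) U"
    by eventually_elim auto
  with eventually_urep[of U "\<lambda>k. fun_int M s (map (\<lambda>t. eval_term ?N e t k) ts)"]
  show ?case
    by eventually_elim (simp add: comp_def)
qed simp

lemma eval_term_ultrapower_in:
  "range e \<subseteq> range (urep U) \<Longrightarrow> eval_term (ultrapower U M) e t \<in> range (urep U)"
  by (cases t) auto

text \<open>Induction on the formula. Negation uses that \<open>U\<close> is an ultrafilter. For the
  existential quantifier, witnesses chosen coordinate by coordinate form a function, and its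
  representative is the witness in the ultrapower.\<close>

lemma los:
  assumes "ultra U" "univ M = UNIV" "range e \<subseteq> range (urep U)"
  shows "sat (ultrapower U M) e \<phi> \<longleftrightarrow> eventually (\<lambda>k. sat M (\<lambda>i. e i k) \<phi>) U"
  using assms(3)
proof (induction \<phi> arbitrary: e)
  case (Equal s t)
  have "eval_term (ultrapower U M) e s = eval_term (ultrapower U M) e t \<longleftrightarrow>
      eventually (\<lambda>k. eval_term (ultrapower U M) e s k = eval_term (ultrapower U M) e t k) U"
    by (intro urep_eq_iff eval_term_ultrapower_in Equal)
  also have "\<dots> \<longleftrightarrow> eventually (\<lambda>k. eval_term M (\<lambda>i. e i k) s = eval_term M (\<lambda>i. e i k) t) U"
    by (rule eventually_cong[OF eventually_conj[OF eval_term_ultrapower[of U M e s]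
          eval_term_ultrapower[of U M e t]]]) auto
  finally show ?case
    by simp
next
  case (Atom r ts)
  have "eventually (\<lambda>k. \<forall>t\<in>set ts. eval_term (ultrapower U M) e t k = eval_term M (\<lambda>i. e i k) t) U"
    by (intro eventually_ball_finite ballI eval_term_ultrapower) auto
  then have "eventually (\<lambda>k. map (\<lambda>t. eval_term (ultrapower U M) e t k) ts
      = map (eval_term M (\<lambda>i. e i k)) ts) U"
    by eventually_elim auto
  then show ?case
    unfolding sat.simps ultrapower_simps map_map comp_def by (rule eventually_cong) (simp only:)
next
  case (Neg \<phi>)
  then show ?case
    by (simp add: ultra_not_iff[OF assms(1)])
next
  case (Conj \<phi> \<psi>)
  then show ?case
    by (simp add: eventually_conj_iff)
next
  case (Exists i \<phi>)
  have e: "(\<lambda>j. (e(i := a)) j k) = (\<lambda>j. e j k)(i := a k)" for a k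
    by auto
  have "sat (ultrapower U M) e (Exists i \<phi>) \<longleftrightarrow>
      (\<exists>a\<in>range (urep U). eventually (\<lambda>k. sat M ((\<lambda>j. e j k)(i := a k)) \<phi>) U)"
    unfolding sat.simps ultrapower_simps e[symmetric]
    using Exists.prems by (intro bex_cong refl Exists.IH) (auto split: if_splits)
  also have "\<dots> \<longleftrightarrow> eventually (\<lambda>k. \<exists>a. sat M ((\<lambda>j. e j k)(i := a)) \<phi>) U"
  proof
    assume *: "eventually (\<lambda>k. \<exists>a. sat M ((\<lambda>j. e j k)(i := a)) \<phi>) U"
    define b where "b k = (SOME a. sat M ((\<lambda>j. e j k)(i := a)) \<phi>)" for k
    from * have "eventually (\<lambda>k. sat M ((\<lambda>j. e j k)(i := b k)) \<phi>) U"
      unfolding b_def by eventually_elim (rule someI_ex)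
    with eventually_urep[of U b]
    have "eventually (\<lambda>k. sat M ((\<lambda>j. e j k)(i := urep U b k)) \<phi>) U"
      by eventually_elim simp
    then show "\<exists>a\<in>range (urep U). eventually (\<lambda>k. sat M ((\<lambda>j. e j k)(i := a k)) \<phi>) U"
      by blast
  qed (auto elim: eventually_mono)
  finally show ?case
    by (simp add: assms(2))
qed

section \<open>Free variables, elementary equivalence and uniform bounds\<close>

lemma finite_free_vars: "finite (free_vars \<phi>)"
proof -
  have "finite (term_vars t)" for t :: "'f fo_term"
    by (induction t) auto
  then show ?thesis
    by (induction \<phi>) auto
qed

lemma eval_term_cong: "(\<And>i. i \<in> term_vars t \<Longrightarrow> e i = e' i) \<Longrightarrow> eval_term M e t = eval_term M e' t"
proof (induction t)
  case (App s ts)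
  then have "map (eval_term M e) ts = map (eval_term M e') ts"
    by auto
  then show ?case
    by (simp only: eval_term.simps)
qed simp

lemma sat_cong: "(\<And>i. i \<in> free_vars \<phi> \<Longrightarrow> e i = e' i) \<Longrightarrow> sat M e \<phi> \<longleftrightarrow> sat M e' \<phi>"
proof (induction \<phi> arbitrary: e e')
  case (Equal s t)
  then have "eval_term M e s = eval_term M e' s" "eval_term M e t = eval_term M e' t"
    by (auto intro!: eval_term_cong)
  then show ?case
    by simp
next
  case (Atom r ts)
  then have "map (eval_term M e) ts = map (eval_term M e') ts"
    by (auto intro!: eval_term_cong)
  then show ?case
    by (simp only: sat.simps)
next
  case (Neg \<phi>)
  have "sat M e \<phi> \<longleftrightarrow> sat M e' \<phi>"
    by (rule Neg.IH) (simp add: Neg.prems)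
  then show ?case
    by simp
next
  case (Conj \<phi> \<psi>)
  have "sat M e \<phi> \<longleftrightarrow> sat M e' \<phi>"
    by (rule Conj.IH) (simp add: Conj.prems)
  moreover have "sat M e \<psi> \<longleftrightarrow> sat M e' \<psi>"
    by (rule Conj.IH) (simp add: Conj.prems)
  ultimately show ?case
    by simp
next
  case (Exists i \<phi>)
  have "sat M (e(i := a)) \<phi> \<longleftrightarrow> sat M (e'(i := a)) \<phi>" for a
    by (intro Exists.IH) (auto simp: Exists.prems)
  then show ?case
    by simp
qed

text \<open>A sentence may be tested on one constant assignment. By \<open>los\<close> its truth in
  the ultrapower means that a truth value independent of the coordinate is eventual along the proper
  filter \<open>U\<close>.\<close>

lemma elementarily_equivalent_ultrapower:
  fixes U :: "'i filter" and M :: "('f, 'r, 'u) fo_structure"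
  assumes "ultra U" "univ M = UNIV"
  shows "elementarily_equivalent L M (ultrapower U M)"
  unfolding elementarily_equivalent_def
proof (intro allI impI)
  fix \<phi> :: "('f, 'r) fo_formula"
  assume \<phi>: "wf_formula L \<phi> \<and> free_vars \<phi> = {}"
  have closed: "models N \<phi> \<longleftrightarrow> sat N e \<phi>" if e: "range e \<subseteq> univ N"
    for N :: "('f, 'r, 'z) fo_structure" and e
  proof
    assume "sat N e \<phi>"
    moreover have "sat N e' \<phi> \<longleftrightarrow> sat N e \<phi>" for e'
      by (rule sat_cong) (simp add: \<phi>)
    ultimately show "models N \<phi>"
      by (simp add: models_def)
  qed (simp add: models_def e)
  obtain a :: "'i \<Rightarrow> 'u" where a: "a \<in> range (urep U)"
    by blast
  have "models (ultrapower U M) \<phi> \<longleftrightarrow> sat (ultrapower U M) (\<lambda>_. a) \<phi>"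
    using a by (intro closed) auto
  also have "\<dots> \<longleftrightarrow> eventually (\<lambda>k. sat M (\<lambda>_. a k) \<phi>) U"
    using a by (subst los[OF assms]) auto
  also have "\<dots> \<longleftrightarrow> models M \<phi>"
  proof -
    have "models M \<phi> \<longleftrightarrow> sat M (\<lambda>_. a k) \<phi>" for k
      by (intro closed) (simp add: assms(2))
    then show ?thesis
      using assms(1) by (simp add: ultra_def)
  qed
  finally show "models M \<phi> \<longleftrightarrow> models (ultrapower U M) \<phi>"
    by simp
qed

text \<open>Compactness, for any notion \<open>Q j\<close> of complexity at most \<open>j\<close>
  that bounds balls and is controlled under boolean operations. If no bound served all parameters,
  bad assignments \<open>e j\<close> would give parameters in an ultrapower where
  \<open>\<phi>\<close> defines a boolean combination of balls. That combination has a single bound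
  \<open>j\<close> in all coordinates, which contradicts the choice of \<open>e k\<close> for
  \<open>k \<ge> j\<close>.\<close>

lemma C_minimal_uniform:
  fixes v :: "'k::field \<Rightarrow> 'g::linordered_ab_group_add extended"
    and Q :: "nat \<Rightarrow> 'k set \<Rightarrow> bool"
  assumes M: "expansion_of_valued_field v L M" and C: "C_minimal L M" and \<phi>: "wf_formula L \<phi>"
    and ball: "\<And>a c. Q 1 {x. v c \<le> v (x - a)}" "\<And>a c. Q 1 {x. v (x - a) \<le> v c}" "Q 1 UNIV"
    and compl: "\<And>i S. Q i S \<Longrightarrow> Q i (- S)"
    and union: "\<And>i j S T. Q i S \<Longrightarrow> Q j T \<Longrightarrow> Q (i + j) (S \<union> T)"
    and mono: "\<And>i j S. Q i S \<Longrightarrow> i \<le> j \<Longrightarrow> Q j S"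
  shows "\<exists>j. \<forall>e. Q j {x. sat M (e(0 := x)) \<phi>}"
proof (rule ccontr)
  assume "\<not> ?thesis"
  then have "\<forall>j. \<exists>e. \<not> Q j {x. sat M (e(0 := x)) \<phi>}"
    by blast
  from choice[OF this] obtain e where e: "\<And>j. \<not> Q j {x. sat M ((e j)(0 := x)) \<phi>}"
    by blast
  \<comment> \<open>Refining \<open>sequentially\<close> makes \<open>j \<le> k\<close> hold for
    almost all \<open>k\<close>, whatever \<open>j\<close> is.\<close>
  obtain U :: "nat filter" where U: "U \<le> sequentially" "ultra U"
    using ex_ultra_le[of sequentially] by auto
  let ?N = "ultrapower U M"
  have M': "univ M = UNIV" "\<And>x y. fun_int M Minus [x, y] = x - y" "fun_int M Zero [] = 0"
    "\<And>x y. rel_int M Div [x, y] \<longleftrightarrow> v x \<le> v y"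
    using M by (auto simp: expansion_of_valued_field_def)
  define e' where "e' i = urep U (\<lambda>k. e k i)" for i
  define S where "S = {x \<in> univ ?N. sat ?N (e'(0 := x)) \<phi>}"
  have "definable_set L ?N 1 ((\<lambda>x. [x]) ` S)"
    unfolding definable_set_def
  proof (intro exI conjI)
    have *: "(\<lambda>i. if i < 1 then [x] ! i else e' i) = e'(0 := x)" for x
      by auto
    have "xs \<in> (\<lambda>x. [x]) ` S \<longleftrightarrow> xs \<in> {xs. length xs = 1 \<and> set xs \<subseteq> univ ?N \<and>
        sat ?N (\<lambda>i. if i < 1 then xs ! i else e' i) \<phi>}" for xs
    proof (cases "\<exists>x. xs = [x]")
      case True
      then obtain x where "xs = [x]" by blast
      then show ?thesis
        using *[of x] by (simp add: S_def image_iff)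
    qed (auto simp: length_Suc_conv)
    then show "(\<lambda>x. [x]) ` S = {xs. length xs = 1 \<and> set xs \<subseteq> univ ?N \<and>
        sat ?N (\<lambda>i. if i < 1 then xs ! i else e' i) \<phi>}"
      by (rule set_eqI)
  qed (auto simp: \<phi> e'_def)
  then have "S \<in> boolean_combinations (univ ?N) (structure_closed_balls ?N \<union> structure_open_balls ?N)"
    by (rule C[unfolded C_minimal_def, rule_format, OF conjI, OF is_structure_ultrapower
      elementarily_equivalent_ultrapower[OF U(2) M'(1)]])
  \<comment> \<open>Boolean combinations of balls are internal: membership is decided by sets
    \<open>B k\<close> in the coordinates, with a common bound. For a ball, these come from the
    coordinates of its centre and of an element giving its radius.\<close>
  then have "\<exists>j B. (\<forall>k. Q j (B k)) \<and> S = {x \<in> univ ?N. eventually (\<lambda>k. x k \<in> B k) U}"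
  proof induction
    case (base S)
    then consider (cl) a c where "S = {x \<in> univ ?N. rel_int ?N Div [c, fun_int ?N Minus [x, a]]}"
      | (univ) "S = univ ?N"
      | (op) a c where "S = {x \<in> univ ?N. \<not> rel_int ?N Div [fun_int ?N Minus [x, a], c]}"
      unfolding structure_closed_balls_def structure_open_balls_def by auto
    then show ?case
    proof cases
      case cl
      have "rel_int ?N Div [c, fun_int ?N Minus [x, a]] \<longleftrightarrow>
          eventually (\<lambda>k. x k \<in> {x. v (c k) \<le> v (x - a k)}) U" for x
        using eventually_urep[of U "\<lambda>k. x k - a k"]
        by (auto simp: M' elim: eventually_elim2)
      then have "S = {x \<in> univ ?N. eventually (\<lambda>k. x k \<in> {x. v (c k) \<le> v (x - a k)}) U}"
        using cl by simp
      then show ?thesis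
        using ball(1) by (intro exI[of _ 1] exI[of _ "\<lambda>k. {x. v (c k) \<le> v (x - a k)}"]) simp
    next
      case univ
      then show ?thesis
        using ball(3) by (intro exI[of _ 1] exI[of _ "\<lambda>_. UNIV"]) simp
    next
      case op
      have "\<not> rel_int ?N Div [fun_int ?N Minus [x, a], c] \<longleftrightarrow>
          eventually (\<lambda>k. x k \<in> - {x. v (x - a k) \<le> v (c k)}) U" for x
        using eventually_urep[of U "\<lambda>k. x k - a k"]
        by (auto simp: M' ultra_not_iff[OF U(2), symmetric] elim: eventually_elim2)
      then have "S = {x \<in> univ ?N. eventually (\<lambda>k. x k \<in> - {x. v (x - a k) \<le> v (c k)}) U}"
        using op by simp
      then show ?thesis
        using compl[OF ball(2)]
        by (intro exI[of _ 1] exI[of _ "\<lambda>k. - {x. v (x - a k) \<le> v (c k)}"]) simp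
    qed
  next
    case (compl S)
    then obtain j B where B: "\<And>k. Q j (B k)" "S = {x \<in> univ ?N. eventually (\<lambda>k. x k \<in> B k) U}"
      by blast
    then have "univ ?N - S = {x \<in> univ ?N. eventually (\<lambda>k. x k \<in> - B k) U}"
      by (auto simp: ultra_not_iff[OF U(2)])
    then show ?case
      using assms(7)[OF B(1)] by (intro exI[of _ j] exI[of _ "\<lambda>k. - B k"]) blast
  next
    case (union S T)
    then obtain i B j B' where B: "\<And>k. Q i (B k)" "S = {x \<in> univ ?N. eventually (\<lambda>k. x k \<in> B k) U}"
      "\<And>k. Q j (B' k)" "T = {x \<in> univ ?N. eventually (\<lambda>k. x k \<in> B' k) U}"
      by blast
    then have "S \<union> T = {x \<in> univ ?N. eventually (\<lambda>k. x k \<in> B k \<union> B' k) U}"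
      by (auto simp: ultra_disj_iff[OF U(2)])
    then show ?case
      using assms(8)[OF B(1,3)] by (intro exI[of _ "i + j"] exI[of _ "\<lambda>k. B k \<union> B' k"]) blast
  qed
  then obtain j B where B: "\<And>k. Q j (B k)" "S = {x \<in> univ ?N. eventually (\<lambda>k. x k \<in> B k) U}"
    by blast
  have S: "urep U x \<in> S \<longleftrightarrow> eventually (\<lambda>k. sat M ((e k)(0 := x k)) \<phi>) U" for x
  proof -
    \<comment> \<open>Only finitely many parameters occur in \<open>\<phi>\<close>, so their
      representatives agree with \<open>e k\<close> simultaneously for almost all
      \<open>k\<close>.\<close>
    obtain m where m: "\<And>i. i \<in> free_vars \<phi> \<Longrightarrow> i < m"
      using finite_free_vars[of \<phi>] unfolding finite_nat_set_iff_bounded by blast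
    have "eventually (\<lambda>k. \<forall>i\<in>{..<m}. e' i k = e k i) U"
      unfolding e'_def by (intro eventually_ball_finite ballI eventually_urep) auto
    moreover have "eventually (\<lambda>k. urep U x k = x k) U"
      by (rule eventually_urep)
    ultimately have *: "eventually (\<lambda>k. sat M (\<lambda>i. (e'(0 := urep U x)) i k) \<phi> \<longleftrightarrow>
        sat M ((e k)(0 := x k)) \<phi>) U"
      by eventually_elim (intro sat_cong, auto dest: m)
    have "urep U x \<in> S \<longleftrightarrow> sat ?N (e'(0 := urep U x)) \<phi>"
      by (simp add: S_def)
    also have "\<dots> \<longleftrightarrow> eventually (\<lambda>k. sat M (\<lambda>i. (e'(0 := urep U x)) i k) \<phi>) U"
      by (intro los U M') (auto simp: e'_def)
    also have "\<dots> \<longleftrightarrow> eventually (\<lambda>k. sat M ((e k)(0 := x k)) \<phi>) U"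
      using * by (simp add: ultra_iff_iff[OF U(2)])
    finally show ?thesis .
  qed
  have S': "urep U x \<in> S \<longleftrightarrow> eventually (\<lambda>k. x k \<in> B k) U" for x
    using eventually_urep[of U x] unfolding B(2) by (auto elim: eventually_elim2)
  \<comment> \<open>Otherwise points chosen in the symmetric differences would form an element of
    the ultrapower on which the two descriptions of \<open>S\<close> disagree.\<close>
  have "eventually (\<lambda>k. {x. sat M ((e k)(0 := x)) \<phi>} = B k) U"
  proof (rule ccontr)
    assume *: "\<not> ?thesis"
    define x where "x k = (SOME x. \<not> (sat M ((e k)(0 := x)) \<phi> \<longleftrightarrow> x \<in> B k))" for k
    from * have "eventually (\<lambda>k. \<exists>x. \<not> (sat M ((e k)(0 := x)) \<phi> \<longleftrightarrow> x \<in> B k)) U"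
      unfolding ultra_not_iff[OF U(2), symmetric] set_eq_iff mem_Collect_eq by simp
    then have "eventually (\<lambda>k. \<not> (sat M ((e k)(0 := x k)) \<phi> \<longleftrightarrow> x k \<in> B k)) U"
      unfolding x_def by (rule eventually_mono) (rule someI_ex)
    then show False
      using S[of x] S'[of x] by (simp only: ultra_not_iff[OF U(2)] ultra_iff_iff[OF U(2)] simp_thms)
  qed
  moreover have "eventually (\<lambda>k. j \<le> k) U"
    using U(1) eventually_ge_at_top by (rule filter_leD)
  ultimately have "eventually (\<lambda>k. Q k {x. sat M ((e k)(0 := x)) \<phi>}) U"
    by eventually_elim (simp add: mono[OF B(1)])
  then show False
    using e U(2) by (simp add: ultra_def)
qed

section \<open>Definability with parameters\<close>

fun rename_term :: "(nat \<Rightarrow> nat) \<Rightarrow> 'f fo_term \<Rightarrow> 'f fo_term" where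
  "rename_term \<rho> (Var i) = Var (\<rho> i)"
| "rename_term \<rho> (App s ts) = App s (map (rename_term \<rho>) ts)"

fun rename :: "(nat \<Rightarrow> nat) \<Rightarrow> ('f, 'r) fo_formula \<Rightarrow> ('f, 'r) fo_formula" where
  "rename \<rho> (Equal s t) = Equal (rename_term \<rho> s) (rename_term \<rho> t)"
| "rename \<rho> (Atom r ts) = Atom r (map (rename_term \<rho>) ts)"
| "rename \<rho> (Neg \<phi>) = Neg (rename \<rho> \<phi>)"
| "rename \<rho> (Conj \<phi> \<psi>) = Conj (rename \<rho> \<phi>) (rename \<rho> \<psi>)"
| "rename \<rho> (Exists i \<phi>) = Exists (\<rho> i) (rename \<rho> \<phi>)"

lemma wf_term_rename: "wf_term L (rename_term \<rho> t) \<longleftrightarrow> wf_term L t"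
  by (induction t) auto

lemma wf_formula_rename: "wf_formula L (rename \<rho> \<phi>) \<longleftrightarrow> wf_formula L \<phi>"
  by (induction \<phi>) (auto simp: wf_term_rename)

lemma eval_term_rename: "eval_term M e (rename_term \<rho> t) = eval_term M (\<lambda>i. e (\<rho> i)) t"
proof (induction t)
  case (App s ts)
  then have "map (eval_term M e \<circ> rename_term \<rho>) ts = map (eval_term M (\<lambda>i. e (\<rho> i))) ts"
    by auto
  then show ?case
    by (simp only: rename_term.simps eval_term.simps map_map)
qed simp

text \<open>Bound variables are renamed too. Injectivity keeps the update at \<open>\<rho> i\<close>
  from changing the value of another variable.\<close>

lemma sat_rename: "inj \<rho> \<Longrightarrow> sat M e (rename \<rho> \<phi>) \<longleftrightarrow> sat M (\<lambda>i. e (\<rho> i)) \<phi>"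
proof (induction \<phi> arbitrary: e)
  case (Atom r ts)
  have "map (eval_term M e \<circ> rename_term \<rho>) ts = map (eval_term M (\<lambda>i. e (\<rho> i))) ts"
    by (simp add: eval_term_rename)
  then show ?case
    by (simp only: rename.simps sat.simps map_map)
next
  case (Exists i \<phi>)
  have "(\<lambda>j. (e(\<rho> i := a)) (\<rho> j)) = (\<lambda>j. e (\<rho> j))(i := a)" for a
    using Exists.prems by (auto simp: inj_eq)
  then show ?case
    by (simp add: Exists.IH[OF Exists.prems])
qed (simp_all add: eval_term_rename)

text \<open>Interleaving, in contrast to the cut-off at \<open>n\<close> in
  \<open>definable_set\<close>, leaves room for any number of arguments and parameters, so that
  predicates carry no arity.\<close>

definition mix :: "(nat \<Rightarrow> 'u) \<Rightarrow> (nat \<Rightarrow> 'u) \<Rightarrow> nat \<Rightarrow> 'u" where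
  "mix e p i = (if even i then e (i div 2) else p (i div 2))"

lemma mix_simps [simp]: "mix e p (2 * i) = e i" "mix e p (Suc (2 * i)) = p i" "mix e p 0 = e 0"
  by (auto simp: mix_def)

locale expansion =
  fixes v :: "'k::field \<Rightarrow> 'g::linordered_ab_group_add extended"
    and L :: "('f vf_fun, 'r vf_rel) signature"
    and M :: "('f vf_fun, 'r vf_rel, 'k) fo_structure"
  assumes expansion: "expansion_of_valued_field v L M"
begin

text \<open>
  The even variables of the formula are the arguments of \<open>P\<close>, the odd ones are parameters. The
  closure properties below treat the arguments as de Bruijn indices.
\<close>

definition dfn :: "((nat \<Rightarrow> 'k) \<Rightarrow> bool) \<Rightarrow> bool" where
  "dfn P \<longleftrightarrow> (\<exists>\<phi> p. wf_formula L \<phi> \<and> (\<forall>e. P e \<longleftrightarrow> sat M (mix e p) \<phi>))"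

text \<open>Functions with definable graph, not just syntactic terms: the given family of functions
  is to be covered. The value occupies argument \<open>0\<close>, the arguments of the function
  follow.\<close>

definition dterm :: "((nat \<Rightarrow> 'k) \<Rightarrow> 'k) \<Rightarrow> bool" where
  "dterm t \<longleftrightarrow> dfn (\<lambda>e. e 0 = t (\<lambda>i. e (Suc i)))"

lemma M_simps:
  "univ M = UNIV" "fun_int M Plus [x, y] = x + y" "fun_int M Minus [x, y] = x - y"
  "rel_int M Div [x, y] \<longleftrightarrow> v x \<le> v y"
  using expansion by (auto simp: expansion_of_valued_field_def)

lemma symbol_arity:
  "fun_arity L Plus = Some 2" "fun_arity L Minus = Some 2" "rel_arity L Div = Some 2"
  using expansion by (auto simp: expansion_of_valued_field_def L_div_def map_le_def)

section \<open>Closure of definable predicates under logical operations\<close>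

lemma dfn_renameI:
  assumes "wf_formula L \<phi>" "inj \<rho>" "\<And>e. P e \<longleftrightarrow> sat M (\<lambda>i. mix e p (\<rho> i)) \<phi>"
  shows "dfn P"
  unfolding dfn_def
  using assms by (intro exI[of _ "rename \<rho> \<phi>"] exI[of _ p]) (simp add: wf_formula_rename sat_rename)

lemma dfn_not:
  assumes "dfn P"
  shows "dfn (\<lambda>e. \<not> P e)"
proof -
  obtain \<phi> p where "wf_formula L \<phi>" "\<And>e. P e \<longleftrightarrow> sat M (mix e p) \<phi>"
    using assms unfolding dfn_def by blast
  then show ?thesis
    unfolding dfn_def by (intro exI[of _ "Neg \<phi>"] exI[of _ p]) simp
qed

lemma dfn_conj:
  assumes "dfn P" "dfn Q"
  shows "dfn (\<lambda>e. P e \<and> Q e)"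
proof -
  obtain \<phi> p where \<phi>: "wf_formula L \<phi>" "\<And>e. P e \<longleftrightarrow> sat M (mix e p) \<phi>"
    using assms unfolding dfn_def by blast
  obtain \<psi> q where \<psi>: "wf_formula L \<psi>" "\<And>e. Q e \<longleftrightarrow> sat M (mix e q) \<psi>"
    using assms unfolding dfn_def by blast
  \<comment> \<open>Both parameter sequences are packed into \<open>mix p q\<close>: parameter
    \<open>j\<close> of the first formula becomes number \<open>2 * j\<close>, that of the second
    number \<open>2 * j + 1\<close>. The arguments stay in place.\<close>
  define \<rho> \<sigma> :: "nat \<Rightarrow> nat" where "\<rho> i = (if even i then i else Suc (2 * (2 * (i div 2))))"
    and "\<sigma> i = (if even i then i else Suc (2 * Suc (2 * (i div 2))))" for i
  have "inj \<rho>" "inj \<sigma>"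
    unfolding \<rho>_def \<sigma>_def by (rule injI, simp split: if_splits; presburger)+
  moreover have "(\<lambda>i. mix e (mix p q) (\<rho> i)) = mix e p" "(\<lambda>i. mix e (mix p q) (\<sigma> i)) = mix e q" for e
    unfolding \<rho>_def \<sigma>_def by (auto simp: fun_eq_iff elim!: evenE oddE simp del: mult_Suc_right)
  ultimately show ?thesis
    unfolding dfn_def using \<phi> \<psi>
    by (intro exI[of _ "Conj (rename \<rho> \<phi>) (rename \<sigma> \<psi>)"] exI[of _ "mix p q"])
      (simp add: sat_rename wf_formula_rename)
qed

lemma dfn_ex:
  assumes "dfn (\<lambda>e. P (e 0) (\<lambda>i. e (Suc i)))"
  shows "dfn (\<lambda>e. \<exists>x. P x e)"
proof -
  obtain \<phi> p where \<phi>: "wf_formula L \<phi>" "\<And>e. P (e 0) (\<lambda>i. e (Suc i)) \<longleftrightarrow> sat M (mix e p) \<phi>"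
    using assms unfolding dfn_def by blast
  \<comment> \<open>Argument \<open>0\<close> moves to variable \<open>1\<close>, to be bound there.
    The other arguments move down one place, and the parameters move up one to vacate variable
    \<open>1\<close>. The \<open>0\<close> heading \<open>q\<close> fills this place and is
    overwritten by the quantifier.\<close>
  define \<rho> :: "nat \<Rightarrow> nat" where "\<rho> i = (if i = 0 then 1 else if even i then i - 2 else i + 2)" for i
  define q where "q = case_nat 0 p"
  have \<rho>: "inj \<rho>"
    unfolding \<rho>_def by (rule injI, simp split: if_splits; presburger)
  have *: "(\<lambda>i. ((mix e q)(Suc 0 := x)) (\<rho> i)) = mix (case_nat x e) p" for e x
  proof
    fix i
    consider "i = 0" | j where "i = 2 * Suc j" | j where "i = Suc (2 * j)"
      by (metis evenE not0_implies_Suc oddE mult_0_right Suc_eq_plus1)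
    then show "((mix e q)(Suc 0 := x)) (\<rho> i) = mix (case_nat x e) p i"
    proof cases
      case 2
      then have "\<rho> i = 2 * j" by (simp add: \<rho>_def)
      then show ?thesis
        using 2 by (simp del: mult_Suc_right)
    next
      case 3
      then have "\<rho> i = Suc (2 * Suc j)" by (simp add: \<rho>_def)
      then show ?thesis
        using 3 by (simp add: q_def del: mult_Suc_right)
    qed (simp add: \<rho>_def)
  qed
  have "P x e \<longleftrightarrow> sat M (mix (case_nat x e) p) \<phi>" for x e
    using \<phi>(2)[of "case_nat x e"] by simp
  then show ?thesis
    unfolding dfn_def using \<phi>(1)
    by (intro exI[of _ "Exists (Suc 0) (rename \<rho> \<phi>)"] exI[of _ q])
      (simp add: wf_formula_rename M_simps sat_rename[OF \<rho>] * del: fun_upd_apply)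
qed

lemma dfn_disj: "dfn P \<Longrightarrow> dfn Q \<Longrightarrow> dfn (\<lambda>e. P e \<or> Q e)"
  using dfn_not[OF dfn_conj[OF dfn_not[of P] dfn_not[of Q]]] by simp

lemma dfn_imp: "dfn P \<Longrightarrow> dfn Q \<Longrightarrow> dfn (\<lambda>e. P e \<longrightarrow> Q e)"
  unfolding imp_conv_disj by (intro dfn_disj dfn_not)

lemma dfn_all:
  assumes "dfn (\<lambda>e. P (e 0) (\<lambda>i. e (Suc i)))"
  shows "dfn (\<lambda>e. \<forall>x. P x e)"
  using dfn_not[OF dfn_ex[of "\<lambda>x e. \<not> P x e"], OF dfn_not[OF assms]] by simp

lemma dfn_comp_inj:
  assumes "dfn P" "inj \<sigma>"
  shows "dfn (\<lambda>e. P (\<lambda>i. e (\<sigma> i)))"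
proof -
  obtain \<phi> p where \<phi>: "wf_formula L \<phi>" "\<And>e. P e \<longleftrightarrow> sat M (mix e p) \<phi>"
    using assms unfolding dfn_def by blast
  define \<rho> where "\<rho> i = (if even i then 2 * \<sigma> (i div 2) else i)" for i
  have "inj \<rho>"
    using assms(2) by (intro injI) (auto simp: \<rho>_def inj_eq split: if_splits elim!: evenE oddE, presburger+)
  moreover have "P (\<lambda>i. e (\<sigma> i)) \<longleftrightarrow> sat M (\<lambda>i. mix e p (\<rho> i)) \<phi>" for e
  proof -
    have "mix (\<lambda>i. e (\<sigma> i)) p = (\<lambda>i. mix e p (\<rho> i))"
      by (auto simp: \<rho>_def fun_eq_iff elim!: evenE oddE)
    then show ?thesis
      by (simp only: \<phi>(2))
  qed
  ultimately show ?thesis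
    using \<phi>(1) by (intro dfn_renameI)
qed

lemma dfn_finite_support:
  assumes "dfn P"
  obtains N where "\<And>e e'. (\<And>i. i < N \<Longrightarrow> e i = e' i) \<Longrightarrow> P e \<longleftrightarrow> P e'"
proof -
  obtain \<phi> p where \<phi>: "\<And>e. P e \<longleftrightarrow> sat M (mix e p) \<phi>"
    using assms unfolding dfn_def by blast
  obtain N where N: "\<And>i. i \<in> free_vars \<phi> \<Longrightarrow> i < N"
    using finite_free_vars[of \<phi>] unfolding finite_nat_set_iff_bounded by blast
  have "P e \<longleftrightarrow> P e'" if *: "\<And>i. i < N \<Longrightarrow> e i = e' i" for e e'
    unfolding \<phi>
  proof (rule sat_cong)
    fix i assume "i \<in> free_vars \<phi>"
    from N[OF this] have "i div 2 < N"
      by linarith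
    then show "mix e p i = mix e' p i"
      by (simp add: mix_def *)
  qed
  then show thesis
    by (rule that)
qed

lemma dfn_atom_Equal:
  assumes "wf_term L s" "wf_term L t"
  shows "dfn (\<lambda>e. eval_term M (mix e p) s = eval_term M (mix e p) t)"
  unfolding dfn_def using assms by (intro exI[of _ "Equal s t"] exI[of _ p]) simp

section \<open>Definable functions and substitution\<close>

lemma dterm_var: "dterm (\<lambda>e. e i)"
  unfolding dterm_def using dfn_atom_Equal[of "Var 0" "Var (2 * Suc i)"]
  by (simp del: mult_Suc_right)

lemma dterm_const: "dterm (\<lambda>_. c)"
  unfolding dterm_def using dfn_atom_Equal[of "Var 0" "Var (Suc (2 * 0))" "\<lambda>_. c"]
  by (simp only: eval_term.simps wf_term.simps mix_simps simp_thms)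

lemma dfn_upd:
  assumes "dterm t" "dfn P"
  shows "dfn (\<lambda>e. P (e(i := t e)))"
proof -
  have "dfn (\<lambda>e. P ((\<lambda>j. e (Suc j))(i := e 0)))"
  proof -
    have "inj (\<lambda>j. if j = i then 0 else Suc j)"
      by (rule injI) (auto split: if_splits)
    from dfn_comp_inj[OF assms(2) this] show ?thesis
      by (rule back_subst[of dfn]) (auto simp: fun_eq_iff intro!: arg_cong[of _ _ P])
  qed
  then have "dfn (\<lambda>e. \<exists>x. x = t e \<and> P (e(i := x)))"
    using assms(1) unfolding dterm_def by (intro dfn_ex dfn_conj) auto
  then show ?thesis
    by simp
qed

lemma dterm_comp_inj:
  assumes "dterm t" "inj \<sigma>"
  shows "dterm (\<lambda>e. t (\<lambda>i. e (\<sigma> i)))"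
proof -
  have "inj (\<lambda>i. case i of 0 \<Rightarrow> 0 | Suc j \<Rightarrow> Suc (\<sigma> j))"
    using assms(2) by (intro injI) (auto simp: inj_eq split: nat.splits)
  from dfn_comp_inj[OF assms(1)[unfolded dterm_def] this] show ?thesis
    by (simp add: dterm_def)
qed

text \<open>Replacing variables one at a time would let later terms see arguments already replaced.
  So the terms first read their arguments \<open>N\<close> places higher, where \<open>N\<close>
  bounds the support of \<open>P\<close>. The lowest \<open>N\<close> places are filled
  successively, and \<open>N\<close> vacuous quantifiers then undo the shift.\<close>

lemma dfn_subst:
  assumes "dfn P" and t: "\<And>i. dterm (t i)"
  shows "dfn (\<lambda>e. P (\<lambda>i. t i e))"
proof -
  obtain N where N: "\<And>e e'. (\<And>i. i < N \<Longrightarrow> e i = e' i) \<Longrightarrow> P e \<longleftrightarrow> P e'"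
    using dfn_finite_support[OF assms(1)] by blast
  have "dfn (\<lambda>e. P (\<lambda>i. if i < k then t i (\<lambda>j. e (j + N)) else e i))" if "k \<le> N" for k
    using that
  proof (induction k)
    case (Suc k)
    have "dterm (\<lambda>e. t k (\<lambda>j. e (j + N)))"
      using t by (rule dterm_comp_inj) (simp add: inj_def)
    from dfn_upd[OF this Suc.IH, of k] Suc.prems show ?case
      by (rule_tac back_subst[of dfn]) (auto simp: fun_eq_iff less_Suc_eq intro!: arg_cong[of _ _ P])
  qed (use assms(1) in simp)
  from this[OF order_refl] have "dfn (\<lambda>e. P (\<lambda>i. t i (\<lambda>j. e (j + N))))"
    by (rule back_subst[of dfn]) (intro ext N, simp)
  then have "dfn (\<lambda>e. P (\<lambda>i. t i (\<lambda>j. e (j + (N - k)))))" if "k \<le> N" for k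
    using that
  proof (induction k)
    case (Suc k)
    then have k: "N - k = Suc (N - Suc k)"
      by simp
    have "dfn (\<lambda>e. P (\<lambda>i. t i (\<lambda>j. e (Suc (j + (N - Suc k))))))"
      using Suc unfolding k by simp
    then have "dfn (\<lambda>e. \<exists>x :: 'k. P (\<lambda>i. t i (\<lambda>j. e (j + (N - Suc k)))))"
      by (rule dfn_ex)
    then show ?case
      by simp
  qed simp
  from this[OF order_refl] show ?thesis
    by simp
qed

lemma dfn_subst2:
  assumes "dfn (\<lambda>e. P (e 0) (e 1))" "dterm s" "dterm t"
  shows "dfn (\<lambda>e. P (s e) (t e))"
proof -
  define r where "r i = (if i = 0 then s else t)" for i :: nat
  have "dfn (\<lambda>e. P (r 0 e) (r 1 e))"
    using assms(1) by (rule dfn_subst[of "\<lambda>e. P (e 0) (e 1)" r]) (use assms in \<open>simp add: r_def\<close>)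
  then show ?thesis
    by (simp add: r_def)
qed

lemma dfn_eq:
  assumes "dterm s" "dterm t"
  shows "dfn (\<lambda>e. s e = t e)"
proof (rule dfn_subst2[where P = "(=)", OF _ assms])
  show "dfn (\<lambda>e. e 0 = e 1)"
    using dfn_atom_Equal[of "Var (2 * 0)" "Var (2 * 1)"]
    by (simp only: eval_term.simps wf_term.simps mix_simps simp_thms)
qed

lemma dfn_vle:
  assumes "dterm s" "dterm t"
  shows "dfn (\<lambda>e. v (s e) \<le> v (t e))"
proof (rule dfn_subst2[where P = "\<lambda>x y. v x \<le> v y", OF _ assms])
  have "wf_formula L (Atom Div [Var (2 * 0), Var (2 * 1)])"
    by (simp add: symbol_arity)
  moreover have "v (e 0) \<le> v (e 1) \<longleftrightarrow> sat M (mix e e) (Atom Div [Var (2 * 0), Var (2 * 1)])" for e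
    by (simp only: sat.simps list.map eval_term.simps mix_simps M_simps)
  ultimately show "dfn (\<lambda>e. v (e 0) \<le> v (e 1))"
    unfolding dfn_def
    by (intro exI[of _ "Atom Div [Var (2 * 0), Var (2 * 1)]"] exI[of _ "\<lambda>_. 0"]) (simp add: mix_def M_simps)
qed

lemma dfn_vless: "dterm s \<Longrightarrow> dterm t \<Longrightarrow> dfn (\<lambda>e. v (s e) < v (t e))"
  using dfn_not[OF dfn_vle[of t s]] by (simp add: not_le)

lemma dfn_veq: "dterm s \<Longrightarrow> dterm t \<Longrightarrow> dfn (\<lambda>e. v (s e) = v (t e))"
  using dfn_conj[OF dfn_vle dfn_vle] by (simp add: order.eq_iff)

lemma dterm_shift: "dterm t \<Longrightarrow> dterm (\<lambda>e. t (\<lambda>i. e (Suc i)))"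
  by (rule dterm_comp_inj[where \<sigma> = Suc]) simp_all

lemma dterm_binop:
  assumes "fun_arity L s = Some 2" "\<And>x y. fun_int M s [x, y] = op x y" "dterm t" "dterm u"
  shows "dterm (\<lambda>e. op (t e) (u e))"
  unfolding dterm_def
proof -
  define r where "r i = (if i = 0 then (\<lambda>e. e 0) else if i = 1 then (\<lambda>e. t (\<lambda>i. e (Suc i)))
    else (\<lambda>e. u (\<lambda>i. e (Suc i))))" for i :: nat
  have r: "dterm (r i)" for i
    using assms(3,4) by (simp add: r_def dterm_shift dterm_var)
  have "dfn (\<lambda>e. e 0 = op (e 1) (e 2))"
    using dfn_atom_Equal[of "Var (2 * 0)" "App s [Var (2 * 1), Var (2 * 2)]"] assms(1,2)
    by (simp del: mult_numeral_left_semiring_numeral) (simp add: mix_def)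
  from dfn_subst[OF this, of r, OF r] show "dfn (\<lambda>e. e 0 = op (t (\<lambda>i. e (Suc i))) (u (\<lambda>i. e (Suc i))))"
    by (simp add: r_def)
qed

lemma dterm_plus: "dterm t \<Longrightarrow> dterm u \<Longrightarrow> dterm (\<lambda>e. t e + u e)"
  by (rule dterm_binop[of Plus]) (auto simp: symbol_arity M_simps)

lemma dterm_minus: "dterm t \<Longrightarrow> dterm u \<Longrightarrow> dterm (\<lambda>e. t e - u e)"
  by (rule dterm_binop[of Minus]) (auto simp: symbol_arity M_simps)

lemma dterm_subst:
  assumes "dterm u" "\<And>i. dterm (t i)"
  shows "dterm (\<lambda>e. u (\<lambda>i. t i e))"
proof -
  define r where "r i = (case i of 0 \<Rightarrow> (\<lambda>e. e 0) | Suc i \<Rightarrow> (\<lambda>e. t i (\<lambda>j. e (Suc j))))" for i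
  have "dterm (r i)" for i
    using assms(2) by (auto simp: r_def dterm_shift dterm_var split: nat.split)
  from dfn_subst[OF assms(1)[unfolded dterm_def], of r, OF this] show ?thesis
    by (simp add: dterm_def r_def)
qed

section \<open>Translation between \<open>dfn\<close> and \<open>definable_set\<close>\<close>

lemma dfn_of_definable_set:
  assumes "definable_set L M N T"
  shows "dfn (\<lambda>e. map e [0..<N] \<in> T)"
proof -
  obtain \<phi> p where \<phi>: "wf_formula L \<phi>" and T: "T = {xs. length xs = N \<and> set xs \<subseteq> univ M \<and>
      sat M (\<lambda>i. if i < N then xs ! i else p i) \<phi>}"
    using assms unfolding definable_set_def by blast
  define \<rho> where "\<rho> i = (if i < N then 2 * i else Suc (2 * i))" for i
  have "inj \<rho>"
    unfolding \<rho>_def by (rule injI, simp split: if_splits; presburger)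
  moreover have "map e [0..<N] \<in> T \<longleftrightarrow> sat M (\<lambda>i. mix e p (\<rho> i)) \<phi>" for e
  proof -
    have "(\<lambda>i. mix e p (\<rho> i)) = (\<lambda>i. if i < N then map e [0..<N] ! i else p i)"
      by (auto simp: \<rho>_def)
    then show ?thesis
      by (simp add: T M_simps)
  qed
  ultimately show ?thesis
    using \<phi> by (intro dfn_renameI)
qed

lemma definable_set_of_dfn:
  assumes "dfn P" "\<And>xs. xs \<in> T \<longleftrightarrow> length xs = N \<and> P (\<lambda>i. if i < N then xs ! i else 0)"
  shows "definable_set L M N T"
proof -
  obtain \<phi> p where \<phi>: "wf_formula L \<phi>" "\<And>e. P e \<longleftrightarrow> sat M (mix e p) \<phi>"
    using assms unfolding dfn_def by blast
  \<comment> \<open>The first \<open>N\<close> arguments become the tuple variables. All other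
    variables move to \<open>N\<close> and beyond, where \<open>q\<close> supplies the parameters
    \<open>p\<close>, and \<open>0\<close> for the arguments from \<open>N\<close> on.\<close>
  define \<rho> where "\<rho> i = (if even i \<and> i div 2 < N then i div 2 else N + i)" for i
  define q where "q i = mix (\<lambda>_. 0) p (i - N)" for i
  have \<rho>: "inj \<rho>"
    by (rule injI) (auto simp: \<rho>_def split: if_splits elim!: evenE)
  have "xs \<in> T \<longleftrightarrow> length xs = N \<and> set xs \<subseteq> univ M \<and>
      sat M (\<lambda>i. if i < N then xs ! i else q i) (rename \<rho> \<phi>)" for xs
  proof -
    have "(\<lambda>i. if \<rho> i < N then xs ! \<rho> i else q (\<rho> i)) = mix (\<lambda>i. if i < N then xs ! i else 0) p"
      by (auto simp: \<rho>_def q_def mix_def fun_eq_iff)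
    then show ?thesis
      by (simp add: assms(2) \<phi>(2) M_simps sat_rename[OF \<rho>])
  qed
  then show ?thesis
    unfolding definable_set_def using \<phi>(1)
    by (intro exI[of _ "rename \<rho> \<phi>"] exI[of _ q]) (auto simp: wf_formula_rename M_simps)
qed

lemma dfn_uniform:
  fixes Q :: "nat \<Rightarrow> 'k set \<Rightarrow> bool"
  assumes "C_minimal L M" "dfn P"
    and "\<And>a c. Q 1 {x. v c \<le> v (x - a)}" "\<And>a c. Q 1 {x. v (x - a) \<le> v c}" "Q 1 UNIV"
    and "\<And>i S. Q i S \<Longrightarrow> Q i (- S)"
    and "\<And>i j S T. Q i S \<Longrightarrow> Q j T \<Longrightarrow> Q (i + j) (S \<union> T)"
    and "\<And>i j S. Q i S \<Longrightarrow> i \<le> j \<Longrightarrow> Q j S"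
  obtains j where "\<And>e. Q j {x. P (case_nat x e)}"
proof -
  obtain \<phi> p where \<phi>: "wf_formula L \<phi>" "\<And>e. P e \<longleftrightarrow> sat M (mix e p) \<phi>"
    using assms(2) unfolding dfn_def by blast
  have "\<exists>j. \<forall>e. Q j {x. sat M (e(0 := x)) \<phi>}"
    by (rule C_minimal_uniform[where Q = Q, OF expansion assms(1) \<phi>(1)]) (fact assms)+
  then obtain j where "\<And>e. Q j {x. sat M (e(0 := x)) \<phi>}"
    by blast
  moreover have "{x. P (case_nat x e)} = {x. sat M ((mix (case_nat 0 e) p)(0 := x)) \<phi>}" for e
  proof (intro Collect_cong)
    fix x
    have "mix (case_nat x e) p = (mix (case_nat 0 e) p)(0 := x)"
      by (auto simp: mix_def fun_eq_iff elim!: evenE split: nat.split)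
    then show "P (case_nat x e) \<longleftrightarrow> sat M ((mix (case_nat 0 e) p)(0 := x)) \<phi>"
      by (simp only: \<phi>(2))
  qed
  ultimately show thesis
    using that[of j] by simp
qed

end

section \<open>The valuation\<close>

context expansion
begin

lemma v_simps [simp]: "v x = \<infinity> \<longleftrightarrow> x = 0" "v x \<noteq> -\<infinity>"
  and v_mult: "v (x * y) = v x + v y"
  and v_add: "min (v x) (v y) \<le> v (x + y)"
  and v_onto: "\<exists>x. v x = Fin \<gamma>"
  and v_nontrivial: "\<exists>x. x \<noteq> 0 \<and> v x \<noteq> 0"
  using expansion by (auto simp: expansion_of_valued_field_def nontrivial_valuation_def)

lemma v_zero [simp]: "v 0 = \<infinity>"
  by simp

lemma v_cases: obtains (zero) "x = 0" "v x = \<infinity>" | (nonzero) \<gamma> where "x \<noteq> 0" "v x = Fin \<gamma>"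
  using v_simps[of x] by (cases "v x") auto

lemma v_one: "v 1 = Fin 0"
  using v_mult[of 1 1] by (cases "1 :: 'k" rule: v_cases) auto

lemma v_minus [simp]: "v (- x) = v x"
proof -
  obtain \<gamma> where \<gamma>: "v (- 1) = Fin \<gamma>"
    by (cases "- 1 :: 'k" rule: v_cases) auto
  then have "\<gamma> + \<gamma> = 0"
    using v_mult[of "- 1" "- 1"] v_one by simp
  then have "v (- 1) = Fin 0"
    using \<gamma> by simp
  then show ?thesis
    using v_mult[of "- 1" x] by (cases x rule: v_cases) auto
qed

lemma v_minus_commute: "v (x - y) = v (y - x)"
  using v_minus[of "x - y"] by simp

lemma v_trans_le: "\<delta> \<le> v (x - y) \<Longrightarrow> \<delta> \<le> v (y - z) \<Longrightarrow> \<delta> \<le> v (x - z)"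
  using v_add[of "x - y" "y - z"] by (auto simp: min_def split: if_splits)

lemma v_trans_less: "\<delta> < v (x - y) \<Longrightarrow> \<delta> < v (y - z) \<Longrightarrow> \<delta> < v (x - z)"
  using v_add[of "x - y" "y - z"] by (auto simp: min_def split: if_splits)

lemma v_diff_eq:
  assumes "v (x - y) < v (y - z)"
  shows "v (x - z) = v (x - y)"
proof (rule antisym)
  show "v (x - y) \<le> v (x - z)"
    using assms by (intro v_trans_le[of _ x y z]) auto
  show "v (x - z) \<le> v (x - y)"
    using v_trans_less[of "v (x - y)" x z y] assms by (auto simp: v_minus_commute[of z y] not_less[symmetric])
qed

lemma v_greater:
  assumes "\<delta> \<noteq> \<infinity>"
  obtains c where "c \<noteq> 0" "\<delta> < v c"
proof -
  obtain x \<epsilon> where x: "x \<noteq> 0" "v x = Fin \<epsilon>" "\<epsilon> \<noteq> 0"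
    using v_nontrivial by (metis v_cases zero_extended_def)
  \<comment> \<open>The absolute value of a nonzero element of the value group: adding it shows that
    there is no largest value.\<close>
  define \<eta> where "\<eta> = max \<epsilon> (- \<epsilon>)"
  have \<eta>: "\<eta> > 0"
    using x(3) by (auto simp: \<eta>_def less_max_iff_disj neq_iff)
  obtain \<gamma> where "\<delta> < Fin \<gamma>"
  proof (cases \<delta>)
    case (Fin \<gamma>)
    then show ?thesis
      using that[of "\<gamma> + \<eta>"] \<eta> by simp
  qed (use assms that[of 0] in auto)
  moreover obtain c where "v c = Fin \<gamma>"
    using v_onto by blast
  ultimately show thesis
    using that[of c] by fastforce
qed

lemma C_rel_strict:
  assumes "v (x - y) < v (x - z)"
  shows "C_rel v y x z"
  using v_diff_eq[of y x z] assms by (simp add: C_rel_def v_minus_commute)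

section \<open>Sets meeting few cones of a closed ball\<close>

text \<open>
  Two points lie in the same cone of a closed ball of radius \<open>v b\<close> iff their difference has value
  greater than \<open>v b\<close>; \<open>small b j T\<close> says that \<open>T\<close> meets at most \<open>j\<close> of them.\<close>

definition separated :: "'k \<Rightarrow> 'k set \<Rightarrow> bool" where
  "separated b P \<longleftrightarrow> finite P \<and> (\<forall>x\<in>P. \<forall>y\<in>P. x \<noteq> y \<longrightarrow> v (x - y) \<le> v b)"

definition small :: "'k \<Rightarrow> nat \<Rightarrow> 'k set \<Rightarrow> bool" where
  "small b j T \<longleftrightarrow> (\<forall>P\<subseteq>T. separated b P \<longrightarrow> card P \<le> j)"

lemma small_subset: "small b j T \<Longrightarrow> S \<subseteq> T \<Longrightarrow> small b j S"
  by (auto simp: small_def)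

lemma small_mono: "small b i T \<Longrightarrow> i \<le> j \<Longrightarrow> small b j T"
  by (meson order_trans small_def)

lemma small_Un:
  assumes "small b i S" "small b j T"
  shows "small b (i + j) (S \<union> T)"
  unfolding small_def
proof (intro allI impI)
  fix P assume P: "P \<subseteq> S \<union> T" "separated b P"
  then have "separated b (P \<inter> S)" "separated b (P \<inter> T)"
    by (auto simp: separated_def)
  then have "card (P \<inter> S) \<le> i" "card (P \<inter> T) \<le> j"
    using assms by (auto simp: small_def)
  moreover have "P = (P \<inter> S) \<union> (P \<inter> T)"
    using P(1) by blast
  ultimately show "card P \<le> i + j"
    using card_Un_le[of "P \<inter> S" "P \<inter> T"] by simp
qed

lemma small_empty: "small b j {}"
  by (auto simp: small_def)

lemma small_one:
  assumes "\<And>x y. x \<in> T \<Longrightarrow> y \<in> T \<Longrightarrow> v b < v (x - y)"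
  shows "small b 1 T"
  unfolding small_def
proof (intro allI impI)
  fix P assume P: "P \<subseteq> T" "separated b P"
  then have "x = y" if "x \<in> P" "y \<in> P" for x y
    using assms that unfolding separated_def by (meson leD subsetD)
  then show "card P \<le> 1"
    using P(2) by (simp add: separated_def card_le_Suc0_iff_eq)
qed

text \<open>Strong minimality for the cones of \<open>D\<close>, with an explicit bound so that it
  can serve as the property \<open>Q j\<close> in \<open>dfn_uniform\<close>.\<close>

definition dichotomy :: "'k \<Rightarrow> 'k set \<Rightarrow> nat \<Rightarrow> 'k set \<Rightarrow> bool" where
  "dichotomy b D j S \<longleftrightarrow> small b j (D \<inter> S) \<or> small b j (D - S)"

lemma dichotomy_compl: "dichotomy b D j S \<Longrightarrow> dichotomy b D j (- S)"
  unfolding dichotomy_def by (simp add: Diff_eq disj_commute)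

lemma dichotomy_Un:
  assumes "dichotomy b D i S" "dichotomy b D j T"
  shows "dichotomy b D (i + j) (S \<union> T)"
proof (cases "small b i (D - S) \<or> small b j (D - T)")
  case True
  then have "small b (i + j) (D - (S \<union> T))"
    by (auto intro: small_subset[OF small_mono])
  then show ?thesis
    by (simp add: dichotomy_def)
next
  case False
  then have "small b (i + j) ((D \<inter> S) \<union> (D \<inter> T))"
    using assms by (intro small_Un) (auto simp: dichotomy_def)
  then show ?thesis
    by (simp add: dichotomy_def Int_Un_distrib)
qed

text \<open>A ball of radius beyond \<open>v b\<close> lies in one cone; any larger ball either
  misses \<open>D\<close> or contains it. In the second claim the ball in question is the open ball
  complementary to the set.\<close>

lemma dichotomy_ball:
  assumes D: "D = {y. v b \<le> v (y - d)}"
  shows "dichotomy b D 1 {x. v c \<le> v (x - a)}" (is "dichotomy b D 1 ?S")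
    and "dichotomy b D 1 {x. v (x - a) \<le> v c}" (is "dichotomy b D 1 ?T")
proof -
  have near: "v b \<le> v (x - y)" if "x \<in> D" "y \<in> D" for x y
    using that v_trans_le[of "v b" x d y] by (simp add: D v_minus_commute)
  show "dichotomy b D 1 ?S"
  proof (cases "v b < v c")
    case True
    have "small b 1 ?S"
      using True v_trans_le[of "v c" _ a] by (intro small_one) (fastforce simp: v_minus_commute[of a])
    from small_subset[OF this Int_lower2[of D]] show ?thesis
      by (simp add: dichotomy_def)
  next
    case False
    have "D \<subseteq> ?S" if y: "y \<in> D \<inter> ?S" for y
    proof (rule subsetI)
      fix x assume "x \<in> D"
      then have "v b \<le> v (x - y)"
        using y by (intro near) simp_all
      with False have "v c \<le> v (x - y)"
        by (meson not_le order_trans)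
      then have "v c \<le> v (x - a)"
        by (rule v_trans_le) (use y in simp)
      then show "x \<in> ?S"
        by simp
    qed
    then have "D \<inter> ?S = {} \<or> D - ?S = {}"
      by blast
    then show ?thesis
      unfolding dichotomy_def by (elim disjE) (simp_all only: small_empty simp_thms)
  qed
  have "dichotomy b D 1 (- ?T)"
  proof (cases "v b \<le> v c")
    case True
    have "small b 1 (- ?T)"
    proof (rule small_one)
      fix x y assume "x \<in> - ?T" "y \<in> - ?T"
      then have "v c < v (x - a)" "v c < v (a - y)"
        by (simp_all add: v_minus_commute[of a y] not_le)
      then have "v c < v (x - y)"
        by (rule v_trans_less)
      with True show "v b < v (x - y)"
        by (rule le_less_trans)
    qed
    from small_subset[OF this Int_lower2[of D]] show ?thesis
      by (simp add: dichotomy_def)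
  next
    case False
    have "D \<subseteq> - ?T" if y: "y \<in> D \<inter> - ?T" for y
    proof (rule subsetI)
      fix x assume "x \<in> D"
      then have "v b \<le> v (x - y)"
        using y by (intro near) simp_all
      with False have "v c < v (x - y)"
        by (simp only: not_le less_le_trans)
      then have "v c < v (x - a)"
        by (rule v_trans_less) (use y in \<open>simp add: not_le\<close>)
      then show "x \<in> - ?T"
        by (simp add: not_le)
    qed
    then have "D \<inter> - ?T = {} \<or> D - (- ?T) = {}"
      by blast
    then show ?thesis
      unfolding dichotomy_def by (elim disjE) (simp_all only: small_empty simp_thms)
  qed
  from dichotomy_compl[OF this] show "dichotomy b D 1 ?T"
    by simp
qed

text \<open>The values \<open>v (c i)\<close> equal \<open>v a\<close> at most once. If the radius
  is at most \<open>v a\<close> (strictly below it for an open ball), membership in the ball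
  compares \<open>v (c i)\<close> with the radius, and such a comparison changes at most once.
  Otherwise membership forces \<open>v (c i) = v a\<close>.\<close>

lemma eventually_const_ball:
  fixes c :: "nat \<Rightarrow> 'k"
  assumes decr: "\<And>i. v (c (Suc i)) < v (c i)"
  shows "(\<forall>\<^sub>F i in sequentially. c i \<in> {x. v e \<le> v (x - a)}) \<or>
      (\<forall>\<^sub>F i in sequentially. c i \<notin> {x. v e \<le> v (x - a)})" (is ?A)
    and "(\<forall>\<^sub>F i in sequentially. c i \<in> {x. v (x - a) \<le> v e}) \<or>
      (\<forall>\<^sub>F i in sequentially. c i \<notin> {x. v (x - a) \<le> v e})" (is ?B)
proof -
  have less: "v (c j) < v (c i)" if "i < j" for i j
    using that by (induction rule: less_Suc_induct) (auto intro: decr order.strict_trans)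
  have ev: "\<forall>\<^sub>F i in sequentially. v (c i) \<noteq> \<delta>" for \<delta>
  proof (cases "\<exists>i. v (c i) = \<delta>")
    case True
    then obtain i where "v (c i) = \<delta>" by blast
    then have "v (c j) \<noteq> \<delta>" if "j \<ge> Suc i" for j
      using less[of i j] that by auto
    then show ?thesis
      unfolding eventually_sequentially by blast
  qed auto
  have ev_le: "(\<forall>\<^sub>F i in sequentially. \<delta> \<le> v (c i)) \<or> (\<forall>\<^sub>F i in sequentially. v (c i) < \<delta>)" for \<delta>
  proof (cases "\<exists>i. v (c i) < \<delta>")
    case True
    then obtain i where "v (c i) < \<delta>" by blast
    then have "v (c j) < \<delta>" if "j \<ge> Suc i" for j
      using less[of i j] that by auto
    then show ?thesis
      unfolding eventually_sequentially by blast
  qed (auto simp: not_less)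
  have eq: "v x = v a" if "v a < v (x - a)" for x
    using v_diff_eq[of 0 a x] that by (simp add: v_minus_commute)
  show ?A
  proof (cases "v e \<le> v a")
    case True
    then have "v e \<le> v (x - a) \<longleftrightarrow> v e \<le> v x" for x
      using v_trans_le[of "v e" x a 0] v_trans_le[of "v e" x 0 a] by auto
    then show ?thesis
      using ev_le[of "v e"] by (simp add: not_le)
  next
    case False
    have "\<forall>\<^sub>F i in sequentially. c i \<notin> {x. v e \<le> v (x - a)}"
      using ev[of "v a"] by eventually_elim (use False eq in fastforce)
    then show ?thesis ..
  qed
  show ?B
  proof (cases "v e < v a")
    case True
    then have "v e < v (x - a) \<longleftrightarrow> v e < v x" for x
      using v_trans_less[of "v e" x a 0] v_trans_less[of "v e" x 0 a] by auto
    then have *: "v (x - a) \<le> v e \<longleftrightarrow> v x \<le> v e" for x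
      by (meson not_le)
    from ev_le[of "v e"] have "(\<forall>\<^sub>F i in sequentially. v (c i) \<le> v e) \<or> (\<forall>\<^sub>F i in sequentially. v e < v (c i))"
    proof
      assume "\<forall>\<^sub>F i in sequentially. v e \<le> v (c i)"
      with ev[of "v e"] have "\<forall>\<^sub>F i in sequentially. v e < v (c i)"
        by eventually_elim auto
      then show ?thesis ..
    next
      assume "\<forall>\<^sub>F i in sequentially. v (c i) < v e"
      then have "\<forall>\<^sub>F i in sequentially. v (c i) \<le> v e"
        by eventually_elim auto
      then show ?thesis ..
    qed
    then show ?thesis
      by (simp add: * not_le)
  next
    case False
    have "v (x - a) \<le> v e" if "v x \<noteq> v a" for x
      using that eq[of x] False by (meson le_less_trans not_le)
    then have "\<forall>\<^sub>F i in sequentially. c i \<in> {x. v (x - a) \<le> v e}"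
      using ev[of "v a"] by (auto elim: eventually_mono)
    then show ?thesis ..
  qed
qed

text \<open>The aim is that an infinite definable set contains an open ball. Unlike that statement,
  this stronger property passes to boolean combinations.\<close>

definition locally_constant_off_finite :: "'k set \<Rightarrow> bool" where
  "locally_constant_off_finite S \<longleftrightarrow> (\<exists>F. finite F \<and> (\<forall>x. x \<notin> F \<longrightarrow>
     (\<exists>c. c \<noteq> 0 \<and> (\<forall>y. v c < v (y - x) \<longrightarrow> (y \<in> S \<longleftrightarrow> x \<in> S)))))"

lemma locally_constant_compl:
  "locally_constant_off_finite S \<Longrightarrow> locally_constant_off_finite (- S)"
  unfolding locally_constant_off_finite_def by simp

lemma locally_constant_Un:
  assumes "locally_constant_off_finite S" "locally_constant_off_finite T"
  shows "locally_constant_off_finite (S \<union> T)"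
proof -
  obtain F where F: "finite F" "\<And>x. x \<notin> F \<Longrightarrow>
      \<exists>c. c \<noteq> 0 \<and> (\<forall>y. v c < v (y - x) \<longrightarrow> (y \<in> S \<longleftrightarrow> x \<in> S))"
    using assms(1) unfolding locally_constant_off_finite_def by blast
  obtain G where G: "finite G" "\<And>x. x \<notin> G \<Longrightarrow>
      \<exists>c. c \<noteq> 0 \<and> (\<forall>y. v c < v (y - x) \<longrightarrow> (y \<in> T \<longleftrightarrow> x \<in> T))"
    using assms(2) unfolding locally_constant_off_finite_def by blast
  have "\<exists>c. c \<noteq> 0 \<and> (\<forall>y. v c < v (y - x) \<longrightarrow> (y \<in> S \<union> T \<longleftrightarrow> x \<in> S \<union> T))" if x: "x \<notin> F \<union> G" for x
  proof -
    obtain c where c: "c \<noteq> 0" "\<And>y. v c < v (y - x) \<Longrightarrow> (y \<in> S \<longleftrightarrow> x \<in> S)"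
      using F(2) x by blast
    obtain d where d: "d \<noteq> 0" "\<And>y. v d < v (y - x) \<Longrightarrow> (y \<in> T \<longleftrightarrow> x \<in> T)"
      using G(2) x by blast
    show ?thesis
    proof (cases "v c \<le> v d")
      case True
      then show ?thesis
        using c d by (intro exI[of _ d]) auto
    next
      case False
      then show ?thesis
        using c d by (intro exI[of _ c]) auto
    qed
  qed
  then show ?thesis
    unfolding locally_constant_off_finite_def using F(1) G(1) by (intro exI[of _ "F \<union> G"]) blast
qed

text \<open>Balls of radius other than \<open>\<infinity>\<close> are open and closed, so they have
  no exceptional points. For the one-point ball the centre is exceptional, and around any other
  \<open>x\<close> the radius \<open>v (x - a)\<close> excludes \<open>a\<close>.\<close>

lemma locally_constant_ball:
  "locally_constant_off_finite {x. v c \<le> v (x - a)}"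
  "locally_constant_off_finite {x. v (x - a) \<le> v c}"
proof -
  have *: "v c \<le> v (y - a) \<longleftrightarrow> v c \<le> v (x - a)" "v c < v (y - a) \<longleftrightarrow> v c < v (x - a)"
    if "v c < v (y - x)" for x y
    using that v_trans_le[of "v c" y x a] v_trans_le[of "v c" x y a]
      v_trans_less[of "v c" y x a] v_trans_less[of "v c" x y a]
    by (auto simp: v_minus_commute[of x y])
  show "locally_constant_off_finite {x. v c \<le> v (x - a)}"
  proof (cases "c = 0")
    case True
    have "y \<noteq> a" if "v (x - a) < v (y - x)" for x y
      using that by (auto simp: v_minus_commute)
    then show ?thesis
      unfolding locally_constant_off_finite_def
      by (intro exI[of _ "{a}"]) (auto simp: True intro!: exI[of _ "_ - a"])
  next
    case False
    then show ?thesis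
      unfolding locally_constant_off_finite_def using *(1) by (intro exI[of _ "{}"]) auto
  qed
  show "locally_constant_off_finite {x. v (x - a) \<le> v c}"
  proof (cases "c = 0")
    case True
    then show ?thesis
      unfolding locally_constant_off_finite_def by (auto intro: exI[of _ "{}"] exI[of _ 1])
  next
    case False
    then show ?thesis
      unfolding locally_constant_off_finite_def using *(2)
      by (intro exI[of _ "{}"]) (auto simp: not_less[symmetric])
  qed
qed

end

section \<open>The lexicographic order on functions\<close>

text \<open>Demanding \<open>f \<delta> \<le> g \<delta>\<close> below \<open>\<gamma>\<close>, in
  place of equality, avoids a first point of difference, which need not exist because
  \<open>A\<close> is not assumed well-ordered.\<close>

definition lexless :: "'a::linorder set \<Rightarrow> ('a \<Rightarrow> 'b::linorder) \<Rightarrow> ('a \<Rightarrow> 'b) \<Rightarrow> bool" where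
  "lexless A f g \<longleftrightarrow> (\<exists>\<gamma>\<in>A. f \<gamma> < g \<gamma> \<and> (\<forall>\<delta>\<in>A. \<delta> < \<gamma> \<longrightarrow> f \<delta> \<le> g \<delta>))"

lemma lexless_asym: "lexless A f g \<Longrightarrow> \<not> lexless A g f"
proof
  assume "lexless A f g" "lexless A g f"
  then obtain \<gamma> \<delta> where "\<gamma> \<in> A" "f \<gamma> < g \<gamma>" "\<forall>\<epsilon>\<in>A. \<epsilon> < \<gamma> \<longrightarrow> f \<epsilon> \<le> g \<epsilon>"
    "\<delta> \<in> A" "g \<delta> < f \<delta>" "\<forall>\<epsilon>\<in>A. \<epsilon> < \<delta> \<longrightarrow> g \<epsilon> \<le> f \<epsilon>"
    unfolding lexless_def by blast
  then show False
    by (metis leD linorder_less_linear order_less_asym)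
qed

text \<open>The smaller of the two witnesses works: one of the inequalities is strict there and the
  other at least weak.\<close>

lemma lexless_trans:
  assumes "lexless A f g" "lexless A g h"
  shows "lexless A f h"
proof -
  obtain \<gamma> where \<gamma>: "\<gamma> \<in> A" "f \<gamma> < g \<gamma>" "\<And>\<epsilon>. \<epsilon> \<in> A \<Longrightarrow> \<epsilon> < \<gamma> \<Longrightarrow> f \<epsilon> \<le> g \<epsilon>"
    using assms(1) unfolding lexless_def by blast
  obtain \<delta> where \<delta>: "\<delta> \<in> A" "g \<delta> < h \<delta>" "\<And>\<epsilon>. \<epsilon> \<in> A \<Longrightarrow> \<epsilon> < \<delta> \<Longrightarrow> g \<epsilon> \<le> h \<epsilon>"
    using assms(2) unfolding lexless_def by blast
  have "f (min \<gamma> \<delta>) < h (min \<gamma> \<delta>)"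
  proof (cases \<gamma> \<delta> rule: linorder_cases)
    case less
    then show ?thesis
      using less less_le_trans[OF \<gamma>(2) \<delta>(3)[OF \<gamma>(1)]] by (simp add: min_absorb1 order_less_imp_le)
  next
    case equal
    then show ?thesis
      using \<gamma>(2) \<delta>(2) by (simp add: min_def)
  next
    case greater
    then show ?thesis
      using greater le_less_trans[OF \<gamma>(3)[OF \<delta>(1)] \<delta>(2)] by (simp add: min_absorb2 order_less_imp_le)
  qed
  moreover have "min \<gamma> \<delta> \<in> A"
    using \<gamma>(1) \<delta>(1) by (simp add: min_def)
  moreover have "f \<epsilon> \<le> h \<epsilon>" if "\<epsilon> \<in> A" "\<epsilon> < min \<gamma> \<delta>" for \<epsilon>
    using \<gamma>(3)[of \<epsilon>] \<delta>(3)[of \<epsilon>] that by (auto intro: order_trans)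
  ultimately show ?thesis
    unfolding lexless_def by blast
qed

text \<open>If neither function is smaller, then the signs of their difference alternate along a
  decreasing sequence.\<close>

lemma lexless_total:
  fixes A :: "'a::linorder set" and f g :: "'a \<Rightarrow> 'b::linorder"
  assumes fg: "\<not> lexless A f g" and gf: "\<not> lexless A g f"
    and const: "\<And>s. (\<And>i. s i \<in> A) \<Longrightarrow> (\<And>i. s (Suc i) < s i) \<Longrightarrow>
      eventually (\<lambda>i. f (s i) < g (s i)) sequentially \<or> eventually (\<lambda>i. \<not> f (s i) < g (s i)) sequentially"
    and A: "\<gamma> \<in> A"
  shows "g \<gamma> \<le> f \<gamma>"
proof (rule ccontr)
  assume \<gamma>: "\<not> g \<gamma> \<le> f \<gamma>"
  define P where "P i \<delta> \<longleftrightarrow> \<delta> \<in> A \<and> (if even i then f \<delta> < g \<delta> else g \<delta> < f \<delta>)" for i :: nat and \<delta>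
  have "\<exists>s. \<forall>i. P i (s i) \<and> s (Suc i) < s i"
  proof (rule dependent_nat_choice)
    show "\<exists>\<delta>. P 0 \<delta>"
      using A \<gamma> unfolding P_def by auto
    show "\<exists>\<epsilon>. P (Suc i) \<epsilon> \<and> \<epsilon> < \<delta>" if "P i \<delta>" for i \<delta>
    proof (cases "even i")
      case True
      then have "\<delta> \<in> A" "f \<delta> < g \<delta>"
        using that by (auto simp: P_def)
      then obtain \<epsilon> where "\<epsilon> \<in> A" "\<epsilon> < \<delta>" "\<not> f \<epsilon> \<le> g \<epsilon>"
        using fg unfolding lexless_def by blast
      then show ?thesis
        using True by (auto simp: P_def not_le)
    next
      case False
      then have "\<delta> \<in> A" "g \<delta> < f \<delta>"
        using that by (auto simp: P_def)
      then obtain \<epsilon> where "\<epsilon> \<in> A" "\<epsilon> < \<delta>" "\<not> g \<epsilon> \<le> f \<epsilon>"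
        using gf unfolding lexless_def by blast
      then show ?thesis
        using False by (auto simp: P_def not_le)
    qed
  qed
  then obtain s where s: "\<And>i. P i (s i)" "\<And>i. s (Suc i) < s i"
    by blast
  have "f (s i) < g (s i) \<longleftrightarrow> even i" for i
    using s(1)[of i] by (auto simp: P_def split: if_splits)
  moreover have "s i \<in> A" for i
    using s(1)[of i] by (simp add: P_def)
  ultimately have "eventually even sequentially \<or> eventually odd sequentially"
    using const[of s] s(2) by simp
  then obtain N :: nat where "(\<forall>n\<ge>N. even n) \<or> (\<forall>n\<ge>N. odd n)"
    unfolding eventually_sequentially by blast
  then show False
    by (metis even_Suc le_Suc_eq order_refl)
qed

section \<open>Definable preorders on a closed ball\<close>

context expansion
begin

text \<open>If the claim fails, every \<open>x\<close> has few predecessors or few successors. A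
  finite separated set of points of the first kind lies below its largest element, so it has at most
  \<open>i\<close> elements; dually for the second kind and \<open>j\<close>. Together these bound
  the number of cones of \<open>D\<close>.\<close>

lemma small_class:
  assumes total: "\<And>x y. x \<in> D \<Longrightarrow> y \<in> D \<Longrightarrow> le x y \<or> le y x"
    and trans: "\<And>x y z. x \<in> D \<Longrightarrow> y \<in> D \<Longrightarrow> z \<in> D \<Longrightarrow> le x y \<Longrightarrow> le y z \<Longrightarrow> le x z"
    and below: "\<And>x. x \<in> D \<Longrightarrow> dichotomy b D i {y. le y x}"
    and above: "\<And>x. x \<in> D \<Longrightarrow> dichotomy b D j {y. le x y}"
    and D: "\<And>k. \<not> small b k D"
  shows "\<exists>x\<in>D. small b (i + j) (D - {y. le x y \<and> le y x})"
proof (rule ccontr)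
  assume *: "\<not> ?thesis"
  define J G where "J x = {y. le y x}" and "G x = {y. le x y}" for x
  have max: "\<exists>x\<in>P. \<forall>y\<in>P. le y x" and min: "\<exists>x\<in>P. \<forall>y\<in>P. le x y"
    if "finite P" "P \<noteq> {}" "P \<subseteq> D" for P
    using that
  proof (induction rule: finite_ne_induct)
    case (insert a P)
    {
      case 1
      then obtain x where "x \<in> P" "\<forall>y\<in>P. le y x"
        using insert.IH(1) by auto
      then show ?case
        using total[of a x] trans[of _ x a] total[of a a] 1 by (metis insert_iff subsetD)
    next
      case 2
      then obtain x where "x \<in> P" "\<forall>y\<in>P. le x y"
        using insert.IH(2) by auto
      then show ?case
        using total[of a x] trans[of a x] total[of a a] 2 by (metis insert_iff subsetD)
    }
  qed (use total in auto)
  \<comment> \<open>If both alternatives failed, the dichotomy would make both complements small.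
    Their union is what \<open>D\<close> has outside the class of \<open>x\<close>.\<close>
  have cover: "small b i (D \<inter> J x) \<or> small b j (D \<inter> G x)" if "x \<in> D" for x
  proof (rule ccontr)
    assume "\<not> ?thesis"
    then have "small b (i + j) ((D - J x) \<union> (D - G x))"
      using below[OF that] above[OF that] by (intro small_Un) (auto simp: dichotomy_def J_def G_def)
    moreover have "(D - J x) \<union> (D - G x) = D - {y. le x y \<and> le y x}"
      by (auto simp: J_def G_def)
    ultimately show False
      using * that by auto
  qed
  have "small b i {x \<in> D. small b i (D \<inter> J x)}"
    unfolding small_def[of b i "{x \<in> D. small b i (D \<inter> J x)}"]
  proof (intro allI impI)
    fix P assume P: "P \<subseteq> {x \<in> D. small b i (D \<inter> J x)}" "separated b P"
    show "card P \<le> i"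
    proof (cases "P = {}")
      case False
      then obtain x where x: "x \<in> P" "\<forall>y\<in>P. le y x"
        using max[of P] P by (auto simp: separated_def)
      then have "P \<subseteq> D \<inter> J x" "small b i (D \<inter> J x)"
        using P(1) by (auto simp: J_def)
      then show ?thesis
        using P(2) by (simp add: small_def)
    qed simp
  qed
  moreover have "small b j {x \<in> D. small b j (D \<inter> G x)}"
    unfolding small_def[of b j "{x \<in> D. small b j (D \<inter> G x)}"]
  proof (intro allI impI)
    fix P assume P: "P \<subseteq> {x \<in> D. small b j (D \<inter> G x)}" "separated b P"
    show "card P \<le> j"
    proof (cases "P = {}")
      case False
      then obtain x where x: "x \<in> P" "\<forall>y\<in>P. le x y"
        using min[of P] P by (auto simp: separated_def)
      then have "P \<subseteq> D \<inter> G x" "small b j (D \<inter> G x)"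
        using P(1) by (auto simp: G_def)
      then show ?thesis
        using P(2) by (simp add: small_def)
    qed simp
  qed
  ultimately have "small b (i + j) D"
    using cover by (intro small_subset[OF small_Un[of b i _ j]]) auto
  with D show False
    by blast
qed

text \<open>If every cone contained a point outside \<open>E\<close>, more than \<open>i\<close>
  separated points could be moved within their cones to separated points of
  \<open>D - E\<close>.\<close>

lemma cone_off_small:
  assumes "small b i (D - E)" "\<And>k. \<not> small b k D"
  shows "\<exists>y\<in>D. \<forall>z\<in>D. v b < v (z - y) \<longrightarrow> z \<in> E"
proof (rule ccontr)
  assume "\<not> ?thesis"
  then obtain t where t: "\<And>y. y \<in> D \<Longrightarrow> t y \<in> D - E" "\<And>y. y \<in> D \<Longrightarrow> v b < v (t y - y)"
    by (metis Diff_iff)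
  obtain P where P: "P \<subseteq> D" "separated b P" "\<not> card P \<le> i"
    using assms(2)[of i] unfolding small_def by blast
  have sep: "v (t x - t y) \<le> v b" if "x \<in> P" "y \<in> P" "x \<noteq> y" for x y
  proof (rule ccontr)
    assume "\<not> ?thesis"
    moreover have "v b < v (x - t x)" "v b < v (t y - y)"
      using t(2)[of x] t(2)[of y] that P(1) by (auto simp: v_minus_commute[of x "t x"])
    ultimately have "v b < v (x - y)"
      using v_trans_less[of "v b" x "t x" "t y"] v_trans_less[of "v b" x "t y" y] by (simp add: not_le)
    with that P(2) show False
      unfolding separated_def by (meson not_le)
  qed
  have inj: "inj_on t P"
  proof (rule inj_onI)
    fix x y assume xy: "x \<in> P" "y \<in> P" "t x = t y"
    show "x = y"
    proof (rule ccontr)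
      assume "x \<noteq> y"
      from sep[OF xy(1,2) this] xy(3) have "v b = \<infinity>"
        by simp
      then show False
        using t(2)[of x] xy(1) P(1) by auto
    qed
  qed
  have "separated b (t ` P)"
    using sep P(2) by (auto simp: separated_def)
  moreover have "t ` P \<subseteq> D - E"
    using t(1) P(1) by blast
  ultimately have "card (t ` P) \<le> i"
    using assms(1) unfolding small_def by blast
  with P(3) show False
    by (simp add: card_image[OF inj])
qed

end

section \<open>Separated sets over an algebraically closed field\<close>

locale C_minimal_expansion = expansion v L M
  for v :: "'k::alg_closed_field \<Rightarrow> 'g::linordered_ab_group_add extended"
    and L :: "('f vf_fun, 'r vf_rel) signature"
    and M :: "('f vf_fun, 'r vf_rel, 'k) fo_structure" +
  assumes C_minimal: "C_minimal L M"
begin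

text \<open>A root \<open>x\<close> of the product of all \<open>X - a\<close>, minus
  \<open>1\<close>, lies in a new residue class. It is integral, since otherwise all factors
  \<open>x - a\<close> would have negative value. The factors then have nonnegative values with sum
  \<open>0\<close>, so each value is \<open>0\<close>.\<close>

lemma residue_field_infinite:
  assumes "finite A" "\<And>a. a \<in> A \<Longrightarrow> Fin 0 \<le> v a"
  shows "\<exists>x. Fin 0 \<le> v x \<and> (\<forall>a\<in>A. v (x - a) \<le> Fin 0)"
proof (cases "A = {}")
  case False
  have neg: "v (\<Prod>a\<in>B. h a) < Fin 0" if "finite B" "B \<noteq> {}" "\<forall>a\<in>B. v (h a) < Fin 0" for B and h :: "'k \<Rightarrow> 'k"
    using that
  proof (induction rule: finite_ne_induct)
    case (insert a B)
    have "v (x * y) < Fin 0" if "v x < Fin 0" "v y < Fin 0" for x y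
      using that by (cases x rule: v_cases; cases y rule: v_cases) (auto simp: v_mult add_neg_neg)
    with insert show ?case
      by simp
  qed auto
  have nonneg: "Fin 0 \<le> v (\<Prod>a\<in>B. h a)" if "finite B" "\<forall>a\<in>B. Fin 0 \<le> v (h a)" for B and h :: "'k \<Rightarrow> 'k"
    using that
  proof (induction rule: finite_induct)
    case (insert a B)
    have "Fin 0 \<le> v (x * y)" if "Fin 0 \<le> v x" "Fin 0 \<le> v y" for x y
      using that by (cases x rule: v_cases; cases y rule: v_cases) (auto simp: v_mult)
    with insert show ?case
      by simp
  qed (simp add: v_one)
  define p where "p = (\<Prod>a\<in>A. [:- a, 1:]) + [:- 1:]"
  have "degree (\<Prod>a\<in>A. [:- a, 1 :: 'k:]) = card A"
    by (subst degree_prod_sum_eq) auto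
  then have "degree p = card A"
    unfolding p_def using False assms(1) by (subst degree_add_eq_left) (auto simp: card_gt_0_iff)
  then have "degree p > 0"
    using False assms(1) by (simp add: card_gt_0_iff)
  then obtain x where "poly p x = 0"
    using alg_closed_imp_poly_has_root by blast
  then have x: "(\<Prod>a\<in>A. x - a) = 1"
    by (simp add: p_def poly_prod)
  have "Fin 0 \<le> v x"
  proof (rule ccontr)
    assume *: "\<not> ?thesis"
    have "v (x - a) < Fin 0" if "a \<in> A" for a
      using v_diff_eq[of x 0 a] assms(2)[OF that] * by (simp add: not_le)
    then show False
      using neg[OF assms(1) False, of "\<lambda>a. x - a"] by (simp add: x v_one)
  qed
  moreover have "v (x - a) \<le> Fin 0" if a: "a \<in> A" for a
  proof (rule ccontr)
    assume *: "\<not> ?thesis"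
    have "\<forall>a\<in>A. Fin 0 \<le> v (x - a)"
      using v_trans_le[of "Fin 0" x 0] \<open>Fin 0 \<le> v x\<close> assms(2) by simp
    then have "Fin 0 \<le> v (\<Prod>a\<in>A - {a}. x - a)"
      using assms(1) by (intro nonneg) auto
    moreover have "(x - a) * (\<Prod>a\<in>A - {a}. x - a) = 1"
      using x prod.remove[OF assms(1) a, of "\<lambda>a. x - a"] by simp
    ultimately show False
      using * v_mult[of "x - a" "\<Prod>a\<in>A - {a}. x - a"]
      by (cases "x - a" rule: v_cases; cases "\<Prod>a\<in>A - {a}. x - a" rule: v_cases)
        (auto simp: v_one not_le dest: add_pos_nonneg)
  qed
  ultimately show ?thesis
    by blast
qed (auto intro: exI[of _ 0])

text \<open>The affine map \<open>d + b * x\<close> carries the valuation ring onto \<open>D\<close>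
  and residue classes onto cones, so any finite separated set in \<open>D\<close> can be enlarged by
  one point.\<close>

lemma closed_ball_not_small:
  assumes D: "D = {y. v b \<le> v (y - d)}" and b: "b \<noteq> 0"
  shows "\<not> small b k D"
proof -
  obtain \<beta> where \<beta>: "v b = Fin \<beta>"
    using b by (cases b rule: v_cases) auto
  have shift: "Fin \<gamma> \<le> v (b * x) \<longleftrightarrow> Fin (\<gamma> - \<beta>) \<le> v x" "v (b * x) \<le> Fin \<gamma> \<longleftrightarrow> v x \<le> Fin (\<gamma> - \<beta>)" for x \<gamma>
    by (cases x rule: v_cases; auto simp: v_mult \<beta> algebra_simps)+
  have ext: "\<exists>x\<in>D. \<forall>a\<in>P. v (x - a) \<le> v b" if P: "finite P" "P \<subseteq> D" for P
  proof -
    have "\<exists>x. Fin 0 \<le> v x \<and> (\<forall>a\<in>(\<lambda>a. (a - d) / b) ` P. v (x - a) \<le> Fin 0)"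
    proof (rule residue_field_infinite)
      fix a assume "a \<in> (\<lambda>a. (a - d) / b) ` P"
      then obtain a' where a': "a' \<in> D" "b * a = a' - d"
        using P(2) b by auto
      then show "Fin 0 \<le> v a"
        using shift(1)[of \<beta> a] by (simp add: D \<beta>)
    qed (use P in simp)
    then obtain x where x: "Fin 0 \<le> v x" "\<And>a. a \<in> P \<Longrightarrow> v (x - (a - d) / b) \<le> Fin 0"
      by auto
    have "v (d + b * x - a) \<le> v b" if "a \<in> P" for a
    proof -
      have "d + b * x - a = b * (x - (a - d) / b)"
        using b by (simp add: field_simps)
      then show ?thesis
        using x(2)[OF that] shift(2)[of "x - (a - d) / b" \<beta>] by (simp add: \<beta>)
    qed
    moreover have "d + b * x \<in> D"
      using x(1) shift(1)[of \<beta> x] by (simp add: D \<beta>)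
    ultimately show ?thesis
      by blast
  qed
  have "\<exists>P\<subseteq>D. separated b P \<and> card P = n" for n
  proof (induction n)
    case (Suc n)
    then obtain P where P: "P \<subseteq> D" "separated b P" "card P = n"
      by blast
    then obtain x where x: "x \<in> D" "\<forall>a\<in>P. v (x - a) \<le> v b"
      using ext[of P] by (auto simp: separated_def)
    have "x \<notin> P"
      using x(2) b by auto
    moreover have "separated b (insert x P)"
      using P(2) x(2) by (auto simp: separated_def v_minus_commute[of _ x])
    ultimately show ?case
      using P x(1) by (intro exI[of _ "insert x P"]) (auto simp: separated_def)
  qed (simp add: separated_def exI[of _ "{}"])
  from this[of "Suc k"] obtain P where "P \<subseteq> D" "separated b P" "\<not> card P \<le> k"
    by auto
  then show ?thesis
    unfolding small_def by blast
qed

lemma dfn_dichotomy: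
  assumes "dfn P" "D = {y. v b \<le> v (y - d)}"
  obtains j where "\<And>e. dichotomy b D j {x. P (case_nat x e)}"
proof (rule dfn_uniform[where Q = "dichotomy b D", OF C_minimal assms(1)])
  show "dichotomy b D 1 UNIV"
    by (simp add: dichotomy_def small_empty)
  show "dichotomy b D j S" if "dichotomy b D i S" "i \<le> j" for i j S
    using that small_mono[of b i _ j] unfolding dichotomy_def by blast
  show thesis if "\<And>e. dichotomy b D j {x. P (case_nat x e)}" for j
    using \<open>\<And>j. (\<And>e. dichotomy b D j {x. P (case_nat x e)}) \<Longrightarrow> thesis\<close> that by blast
qed (rule dichotomy_ball[OF assms(2)] dichotomy_compl dichotomy_Un; assumption)+

text \<open>Eventual constancy along \<open>c\<close> passes from balls to boolean combinations.
  This excludes the alternating signs in \<open>lexless_total\<close>.\<close>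

lemma dfn_eventually_const:
  fixes c :: "nat \<Rightarrow> 'k"
  assumes "dfn (\<lambda>e. P (e 0))" "\<And>i. v (c (Suc i)) < v (c i)"
  shows "eventually (\<lambda>i. P (c i)) sequentially \<or> eventually (\<lambda>i. \<not> P (c i)) sequentially"
proof -
  define Q where "Q j S \<longleftrightarrow> eventually (\<lambda>i. c i \<in> S) sequentially \<or> eventually (\<lambda>i. c i \<notin> S) sequentially"
    for j :: nat and S
  show ?thesis
  proof (rule dfn_uniform[where Q = Q, OF C_minimal assms(1)])
    show "Q 1 {x. v e \<le> v (x - a)}" "Q 1 {x. v (x - a) \<le> v e}" for a e
      unfolding Q_def using eventually_const_ball[of c, OF assms(2)] by blast+
    show "Q (i + j) (S \<union> T)" if "Q i S" "Q j T" for i j S T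
    proof (cases "eventually (\<lambda>i. c i \<in> S) sequentially \<or> eventually (\<lambda>i. c i \<in> T) sequentially")
      case True
      then have "eventually (\<lambda>i. c i \<in> S \<union> T) sequentially"
        by (auto elim: eventually_mono)
      then show ?thesis
        by (simp add: Q_def)
    next
      case False
      then have "eventually (\<lambda>i. c i \<notin> S \<union> T) sequentially"
        using that by (simp add: Q_def eventually_conj_iff)
      then show ?thesis
        by (simp add: Q_def)
    qed
    fix j assume "\<And>e. Q j {x. P (case_nat x e 0)}"
    then show ?thesis
      by (simp add: Q_def)
  qed (auto simp: Q_def)
qed

lemma dfn_locally_constant:
  assumes "dfn (\<lambda>e. P (e 0))"
  shows "locally_constant_off_finite {x. P x}"
proof (rule dfn_uniform[where Q = "\<lambda>_. locally_constant_off_finite", OF C_minimal assms])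
  show "locally_constant_off_finite UNIV"
    unfolding locally_constant_off_finite_def by (intro exI[of _ "{}"]) (auto intro: exI[of _ 1])
qed (simp_all add: locally_constant_ball locally_constant_compl locally_constant_Un)

section \<open>Maps preserving the C-relation\<close>

text \<open>The part of \<open>C_isomorphism\<close> that restricts to arbitrary subsets, in
  particular to closed subballs, with no condition on the image.\<close>

definition C_preserving :: "'k set \<Rightarrow> ('k \<Rightarrow> 'k) \<Rightarrow> bool" where
  "C_preserving B g \<longleftrightarrow> (\<forall>x\<in>B. \<forall>y\<in>B. \<forall>z\<in>B. C_rel v x y z \<longleftrightarrow> C_rel v (g x) (g y) (g z))"

lemma C_preserving_subset: "C_preserving B g \<Longrightarrow> A \<subseteq> B \<Longrightarrow> C_preserving A g"
  unfolding C_preserving_def by blast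

lemma C_preserving_cong: "C_preserving B g \<Longrightarrow> (\<And>x. x \<in> B \<Longrightarrow> g x = k x) \<Longrightarrow> C_preserving B k"
  unfolding C_preserving_def by simp

text \<open>The relation \<open>C_rel v x y y\<close> expresses that \<open>x\<close> and
  \<open>y\<close> are distinct.\<close>

lemma C_preserving_inj:
  assumes "C_preserving B g" "x \<in> B" "y \<in> B" "x \<noteq> y"
  shows "g x \<noteq> g y"
proof -
  have "C_rel v x y y"
    using assms(4) by (cases "x - y" rule: v_cases) (auto simp: C_rel_def)
  then have "C_rel v (g x) (g y) (g y)"
    using assms by (simp add: C_preserving_def)
  then show ?thesis
    by (auto simp: C_rel_def)
qed

text \<open>Either \<open>y\<close> and \<open>z\<close> are closer to each other than to
  \<open>x\<close>, and \<open>C_rel v x y z\<close> is preserved, or neither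
  \<open>C_rel v y x z\<close> nor \<open>C_rel v z x y\<close> holds. In the second case unequal
  image distances would create one of these relations between the images.\<close>

lemma C_preserving_dist:
  assumes g: "C_preserving B g" and B: "x \<in> B" "y \<in> B" "z \<in> B" and eq: "v (x - y) = v (x - z)"
  shows "v (g x - g y) = v (g x - g z)"
proof (cases "v (x - y) < v (y - z)")
  case True
  then have "C_rel v x y z"
    using eq by (simp add: C_rel_def)
  then show ?thesis
    using g B by (simp add: C_preserving_def C_rel_def)
next
  case False
  then have "\<not> C_rel v y x z" "\<not> C_rel v z x y"
    using eq by (auto simp: C_rel_def v_minus_commute)
  then have "\<not> C_rel v (g y) (g x) (g z)" "\<not> C_rel v (g z) (g x) (g y)"
    using g B by (auto simp: C_preserving_def)
  then show ?thesis
    using C_rel_strict[of "g x" "g y" "g z"] C_rel_strict[of "g x" "g z" "g y"]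
    by (meson linorder_less_linear)
qed

text \<open>Points of \<open>D\<close> are preordered by the functions sending \<open>v c\<close> to
  \<open>v (g (x + c) - g x)\<close>. One class contains a whole cone, and there these functions
  coincide. The condition on four points states factorization over the value group without naming
  the function.\<close>

lemma exists_factorizing_cone:
  assumes D: "D = {y. v b \<le> v (y - d)}" "b \<noteq> 0" and g: "C_preserving D g"
    and dg: "dterm (\<lambda>e. g (e 0))"
  shows "\<exists>y\<in>D. \<forall>z1 z2 z3 z4. v b < v (z1 - y) \<and> v b < v (z2 - y) \<and> v b < v (z3 - y) \<and> v b < v (z4 - y) \<and>
    v (z1 - z2) = v (z3 - z4) \<longrightarrow> v (g z1 - g z2) = v (g z3 - g z4)"
proof -
  \<comment> \<open>Displacements \<open>c\<close> in the field stand for values, so that the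
    comparison below is definable by quantifiers over the field. By \<open>dep\<close>, only
    \<open>v c\<close> matters.\<close>
  define u where "u x c = v (g (x + c) - g x)" for x c
  have add_D: "x + c \<in> D" if "x \<in> D" "v b < v c" for x c
    using that v_trans_le[of "v b" "x + c" x d] by (simp add: D(1))
  have dep: "u x c = u x c'" if "x \<in> D" "v b < v c" "v c = v c'" for x c c'
    using C_preserving_dist[OF g, of x "x + c" "x + c'"] that
    by (simp add: u_def add_D v_minus_commute[of "g x"])
  obtain s where s: "\<And>\<gamma>. v (s \<gamma>) = Fin \<gamma>"
    using v_onto by metis
  define A where "A = {\<gamma>. v b < Fin \<gamma>}"
  define h where "h x \<gamma> = u x (s \<gamma>)" for x \<gamma>
  have u_h: "u x c = h x \<gamma>" if "x \<in> D" "\<gamma> \<in> A" "v c = Fin \<gamma>" for x c \<gamma>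
    unfolding h_def using that by (intro dep) (auto simp: A_def s)
  define lt where "lt x y \<longleftrightarrow> (\<exists>c. v b < v c \<and> u x c < u y c \<and>
    (\<forall>c'. v b < v c' \<and> v c' < v c \<longrightarrow> u x c' \<le> u y c'))" for x y
  have lt: "lt x y \<longleftrightarrow> lexless A (h x) (h y)" if xy: "x \<in> D" "y \<in> D" for x y
  proof
    assume "lt x y"
    then obtain c where c: "v b < v c" "u x c < u y c" "\<And>c'. v b < v c' \<Longrightarrow> v c' < v c \<Longrightarrow> u x c' \<le> u y c'"
      unfolding lt_def by blast
    have "c \<noteq> 0"
      using c(2) by (auto simp: u_def)
    then obtain \<gamma> where \<gamma>: "v c = Fin \<gamma>"
      by (cases c rule: v_cases) auto
    have A: "\<gamma> \<in> A"
      using c(1) \<gamma> by (simp add: A_def)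
    have "h x \<gamma> < h y \<gamma>"
      using c(2) u_h[OF xy(1) A \<gamma>] u_h[OF xy(2) A \<gamma>] by simp
    moreover have "h x \<delta> \<le> h y \<delta>" if "\<delta> \<in> A" "\<delta> < \<gamma>" for \<delta>
      using c(3)[of "s \<delta>"] that \<gamma> by (simp add: A_def s h_def)
    ultimately show "lexless A (h x) (h y)"
      using A unfolding lexless_def by blast
  next
    assume "lexless A (h x) (h y)"
    then obtain \<gamma> where \<gamma>: "\<gamma> \<in> A" "h x \<gamma> < h y \<gamma>" "\<And>\<delta>. \<delta> \<in> A \<Longrightarrow> \<delta> < \<gamma> \<Longrightarrow> h x \<delta> \<le> h y \<delta>"
      unfolding lexless_def by blast
    have "u x c' \<le> u y c'" if c': "v b < v c'" "v c' < v (s \<gamma>)" for c'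
    proof -
      have "c' \<noteq> 0"
        using c'(2) by auto
      then obtain \<delta> where \<delta>: "v c' = Fin \<delta>"
        by (cases c' rule: v_cases) auto
      then have "\<delta> \<in> A" "\<delta> < \<gamma>"
        using c' by (simp_all add: A_def s)
      then show ?thesis
        using \<gamma>(3) u_h[OF xy(1) _ \<delta>] u_h[OF xy(2) _ \<delta>] by simp
    qed
    then show "lt x y"
      unfolding lt_def using \<gamma>(1,2) by (intro exI[of _ "s \<gamma>"]) (auto simp: A_def s h_def)
  qed
  have dterm_g: "dterm (\<lambda>e. g (t e))" if "dterm t" for t
    using dterm_subst[OF dg, of "\<lambda>_. t"] that by simp
  \<comment> \<open>The set of \<open>c\<close> with \<open>u x c < u y c\<close> is definable,
    hence eventually constant along decreasing values. Incomparable points therefore have equal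
    functions on \<open>A\<close>.\<close>
  have eq: "h x \<gamma> = h y \<gamma>" if "\<not> lt x y" "\<not> lt y x" and xy: "x \<in> D" "y \<in> D" "\<gamma> \<in> A" for x y \<gamma>
  proof -
    have const: "eventually (\<lambda>i. h x (t i) < h y (t i)) sequentially \<or>
        eventually (\<lambda>i. \<not> h x (t i) < h y (t i)) sequentially"
      if xy: "x \<in> D" "y \<in> D" and t: "\<And>i. t (Suc i) < t i" for x y t
    proof -
      have "dfn (\<lambda>e. u x (e 0) < u y (e 0))"
        unfolding u_def by (intro dfn_vless dterm_minus dterm_g dterm_plus dterm_const dterm_var)
      from dfn_eventually_const[OF this, of "\<lambda>i. s (t i)"] show ?thesis
        using t by (simp add: s h_def)
    qed
    have "h y \<gamma> \<le> h x \<gamma>"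
      by (rule lexless_total[of A "h x" "h y", OF _ _ const xy(3)]) (use that lt in auto)
    moreover have "h x \<gamma> \<le> h y \<gamma>"
      by (rule lexless_total[of A "h y" "h x", OF _ _ const xy(3)]) (use that lt in auto)
    ultimately show ?thesis
      by simp
  qed
  have dlt: "dfn (\<lambda>e. lt (t e) (t' e))" if "dterm t" "dterm t'" for t t'
    unfolding lt_def u_def
    by (intro dfn_ex dfn_all dfn_conj dfn_imp dfn_vless dfn_vle dterm_minus dterm_g dterm_plus dterm_const
        dterm_var dterm_shift that)
  have not_small: "\<not> small b k D" for k
    by (rule closed_ball_not_small[OF D])
  \<comment> \<open>The parameter \<open>x\<close> is argument \<open>1\<close> and the point
    \<open>y\<close> argument \<open>0\<close>, so \<open>i\<close> bounds all initial segments at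
    once; \<open>j\<close> below does so for the final segments.\<close>
  obtain i where i: "\<And>e. dichotomy b D i {y. \<not> lt (case_nat y e 1) (case_nat y e 0)}"
    by (rule dfn_dichotomy[OF dfn_not[OF dlt[OF dterm_var[of 1] dterm_var[of 0]]] D(1)]) blast
  obtain j where j: "\<And>e. dichotomy b D j {y. \<not> lt (case_nat y e 0) (case_nat y e 1)}"
    by (rule dfn_dichotomy[OF dfn_not[OF dlt[OF dterm_var[of 0] dterm_var[of 1]]] D(1)]) blast
  have "\<exists>x\<in>D. small b (i + j) (D - {y. \<not> lt y x \<and> \<not> lt x y})"
  proof (rule small_class[of D "\<lambda>x y. \<not> lt y x"])
    show "\<not> lt y x \<or> \<not> lt x y" if "x \<in> D" "y \<in> D" for x y
      using that lexless_asym by (auto simp: lt)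
    show "\<not> lt z x" if D': "x \<in> D" "y \<in> D" "z \<in> D" and n: "\<not> lt y x" "\<not> lt z y" for x y z
    proof
      assume zx: "lt z x"
      show False
      proof (cases "lt x y")
        case True
        then show ?thesis
          using zx n(2) D' lexless_trans by (auto simp: lt)
      next
        \<comment> \<open>Now \<open>x\<close> and \<open>y\<close> are incomparable, so
          \<open>h x\<close> and \<open>h y\<close> agree on \<open>A\<close> and \<open>x\<close>
          may be replaced by \<open>y\<close> in \<open>lt z x\<close>.\<close>
        case False
        then have "h x \<gamma> = h y \<gamma>" if "\<gamma> \<in> A" for \<gamma>
          using eq n(1) D' that by blast
        then have "lexless A (h z) (h y)"
          using zx D' by (auto simp: lt lexless_def)
        then show False
          using n(2) D' by (simp add: lt)
      qed
    qed
    show "dichotomy b D i {y. \<not> lt x y}" for x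
      using i[of "\<lambda>_. x"] by simp
    show "dichotomy b D j {y. \<not> lt y x}" for x
      using j[of "\<lambda>_. x"] by simp
  qed (rule not_small)
  then obtain x where x: "x \<in> D" "small b (i + j) (D - {y. \<not> lt y x \<and> \<not> lt x y})"
    by blast
  from cone_off_small[OF x(2) not_small] obtain y where y: "y \<in> D"
    "\<And>z. z \<in> D \<Longrightarrow> v b < v (z - y) \<Longrightarrow> \<not> lt z x \<and> \<not> lt x z"
    by blast
  \<comment> \<open>The point \<open>z'\<close> of the cone is equivalent to the fixed
    \<open>x\<close>, so the displacement \<open>z - z'\<close> may be evaluated with
    \<open>h x\<close>.\<close>
  have cone: "v (g z - g z') = (if z = z' then \<infinity> else h x \<gamma>)"
    if "v b < v (z - y)" "v b < v (z' - y)" "v (z - z') = Fin \<gamma> \<or> z = z'" for z z' \<gamma>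
  proof (cases "z = z'")
    case False
    have zD: "z' \<in> D"
      using add_D[OF y(1) that(2)] by simp
    have "v b < v (z - z')"
      using that(1,2) v_trans_less[of "v b" z y z'] by (simp add: v_minus_commute)
    then have "\<gamma> \<in> A"
      using that(3) False by (simp add: A_def)
    then have "u z' (z - z') = h x \<gamma>"
      using u_h[OF zD, of \<gamma> "z - z'"] eq[OF _ _ zD x(1)] y(2)[OF zD that(2)] that(3) False by simp
    then show ?thesis
      using False by (simp add: u_def)
  qed simp
  show ?thesis
  proof (intro bexI[OF _ y(1)] allI impI, elim conjE)
    fix z1 z2 z3 z4
    assume z: "v b < v (z1 - y)" "v b < v (z2 - y)" "v b < v (z3 - y)" "v b < v (z4 - y)"
      "v (z1 - z2) = v (z3 - z4)"
    show "v (g z1 - g z2) = v (g z3 - g z4)"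
    proof (cases "z1 - z2" rule: v_cases)
      case zero
      with z(5) have "v (z3 - z4) = \<infinity>"
        by simp
      then have "z3 = z4"
        by simp
      with zero show ?thesis
        by simp
    next
      case (nonzero \<gamma>)
      with z(5) have "z3 \<noteq> z4"
        by auto
      then show ?thesis
        using cone[of z1 z2 \<gamma>] cone[of z3 z4 \<gamma>] z nonzero by auto
    qed
  qed
qed

end

section \<open>Coding of points\<close>

context expansion
begin

definition val :: "'k \<Rightarrow> 'g" where
  "val c = (THE \<gamma>. v c = Fin \<gamma>)"

lemma val_eq: "v c = Fin \<gamma> \<Longrightarrow> val c = \<gamma>"
  by (simp add: val_def)

lemma Fin_val: "c \<noteq> 0 \<Longrightarrow> v c = Fin (val c)"
  by (cases c rule: v_cases) (auto simp: val_eq)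

text \<open>The first \<open>N\<close> arguments are field coordinates; the next \<open>k\<close>
  are nonzero field elements representing the coordinates in the value group. This is the preimage
  used in \<open>definable\<close>.\<close>

definition coded :: "nat \<Rightarrow> nat \<Rightarrow> ('k, 'g) point set \<Rightarrow> (nat \<Rightarrow> 'k) \<Rightarrow> bool" where
  "coded N k S e \<longleftrightarrow> (\<forall>i<k. e (N + i) \<noteq> 0) \<and>
     (map e [0..<N], map (\<lambda>i. val (e (N + i))) [0..<k]) \<in> S"

lemma definable_iff:
  "definable v L M N k S \<longleftrightarrow> (\<forall>(a, g)\<in>S. length a = N \<and> length g = k) \<and> dfn (coded N k S)"
proof (cases "\<forall>(a, g)\<in>S. length a = N \<and> length g = k")
  case True
  define T where "T = {a @ b | a b g. (a, g) \<in> S \<and> list_all2 (\<lambda>y \<gamma>. v y = Fin \<gamma>) b g}"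
  have codes: "list_all2 (\<lambda>y \<gamma>. v y = Fin \<gamma>) b g \<longleftrightarrow> (\<forall>c\<in>set b. c \<noteq> 0) \<and> g = map val b" for b g
  proof (induction b arbitrary: g)
    case (Cons c b)
    show ?case
    proof (cases g)
      case (Cons \<gamma> g')
      have "v c = Fin \<gamma> \<longleftrightarrow> c \<noteq> 0 \<and> \<gamma> = val c"
        using Fin_val[of c] by (auto simp: val_eq)
      then show ?thesis
        using Cons.IH[of g'] Cons by auto
    qed simp
  qed simp
  have split: "map e [0..<N + k] = map e [0..<N] @ map (\<lambda>i. e (N + i)) [0..<k]" for e :: "nat \<Rightarrow> 'k"
    by (rule nth_equalityI) (auto simp: nth_append)
  have coded: "coded N k S e \<longleftrightarrow> map e [0..<N + k] \<in> T" for e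
  proof -
    have "a @ b \<in> T \<longleftrightarrow> (\<forall>c\<in>set b. c \<noteq> 0) \<and> (a, map val b) \<in> S" if "length a = N" for a b
    proof -
      have "aa = a \<and> bb = b" if "a @ b = aa @ bb" "(aa, g) \<in> S" for aa bb g
      proof -
        have "length aa = length a"
          using True that(2) \<open>length a = N\<close> by auto
        with that(1) show ?thesis
          by simp
      qed
      then show ?thesis
        unfolding T_def codes by blast
    qed
    then show ?thesis
      unfolding split coded_def by (auto simp: comp_def)
  qed
  have T: "length xs = N + k" if "xs \<in> T" for xs
    using that True unfolding T_def by (fastforce dest: list_all2_lengthD)
  have "definable_set L M (N + k) T \<longleftrightarrow> dfn (coded N k S)"
  proof
    assume "definable_set L M (N + k) T"
    from dfn_of_definable_set[OF this] show "dfn (coded N k S)"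
      by (simp add: coded[abs_def])
  next
    assume *: "dfn (coded N k S)"
    show "definable_set L M (N + k) T"
    proof (rule definable_set_of_dfn[OF *])
      fix xs :: "'k list"
      have "map (\<lambda>i. if i < N + k then xs ! i else 0) [0..<N + k] = xs" if "length xs = N + k"
        using that by (intro nth_equalityI) auto
      then show "xs \<in> T \<longleftrightarrow> length xs = N + k \<and> coded N k S (\<lambda>i. if i < N + k then xs ! i else 0)"
        using T by (auto simp: coded)
    qed
  qed
  then show ?thesis
    using True unfolding definable_def T_def by blast
qed (auto simp: definable_def)

definition valid :: "nat \<Rightarrow> nat \<Rightarrow> (nat \<Rightarrow> 'k) \<Rightarrow> bool" where
  "valid n m p \<longleftrightarrow> (\<forall>i<m. p (n + i) \<noteq> 0)"

definition point :: "nat \<Rightarrow> nat \<Rightarrow> (nat \<Rightarrow> 'k) \<Rightarrow> ('k, 'g) point" where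
  "point n m p = (map p [0..<n], map (\<lambda>i. val (p (n + i))) [0..<m])"

text \<open>Since \<open>add_K\<close> inserts field coordinates before the representatives of
  values, a code of the base point is recovered from a code of the extended point by omitting
  \<open>j\<close> places from \<open>n\<close> on.\<close>

definition skip :: "nat \<Rightarrow> nat \<Rightarrow> (nat \<Rightarrow> 'k) \<Rightarrow> nat \<Rightarrow> 'k" where
  "skip n j e i = e (if i < n then i else i + j)"

lemma ex_code:
  assumes "length (fst w) = n" "length (snd w) = m"
  obtains p where "valid n m p" "point n m p = w"
proof -
  obtain s where s: "\<And>\<gamma>. v (s \<gamma>) = Fin \<gamma>"
    using v_onto by metis
  define p where "p i = (if i < n then fst w ! i else s (snd w ! (i - n)))" for i
  have "s \<gamma> \<noteq> 0" for \<gamma>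
    using s[of \<gamma>] by auto
  then have "valid n m p"
    by (simp add: valid_def p_def)
  moreover have "map p [0..<n] = fst w" "map (\<lambda>i. val (p (n + i))) [0..<m] = snd w"
    using assms val_eq[OF s] by (auto intro!: nth_equalityI simp: p_def)
  ultimately show thesis
    using that by (simp add: point_def)
qed

lemma map_skip:
  "map (skip n j e) [0..<n] = map e [0..<n]"
  "map (\<lambda>i. val (skip n j e (n + i))) [0..<m] = map (\<lambda>i. val (e (n + j + i))) [0..<m]"
  by (auto simp: skip_def ac_simps)

lemma coded_add_K:
  "coded (n + 1) m {add_K w x | w x. R w x} e \<longleftrightarrow>
    valid n m (skip n 1 e) \<and> R (point n m (skip n 1 e)) (e n)"
proof -
  have "(a @ [x], g) \<in> {add_K w x | w x. R w x} \<longleftrightarrow> R (a, g) x" for a x g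
    by auto
  then show ?thesis
    unfolding coded_def valid_def point_def map_skip by (simp add: skip_def)
qed

lemma coded_add_K_add_K:
  "coded (n + 2) m {add_K (add_K w x) y | w x y. R w x y} e \<longleftrightarrow>
    valid n m (skip n 2 e) \<and> R (point n m (skip n 2 e)) (e n) (e (n + 1))"
proof -
  have "(a @ [x, y], g) \<in> {add_K (add_K w x) y | w x y. R w x y} \<longleftrightarrow> R (a, g) x y" for a x y g
    by auto
  then show ?thesis
    unfolding coded_def valid_def point_def map_skip by (simp add: skip_def)
qed

lemma coded_add_VG:
  "coded N (k + 1) {add_VG w \<gamma> | w \<gamma>. R w \<gamma>} e \<longleftrightarrow>
    coded N k {w. R w (val (e (N + k)))} e \<and> e (N + k) \<noteq> 0"
proof -
  have "(a, g @ [\<gamma>]) \<in> {add_VG w \<gamma> | w \<gamma>. R w \<gamma>} \<longleftrightarrow> R (a, g) \<gamma>" for a g \<gamma>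
    by auto
  then show ?thesis
    unfolding coded_def by (auto simp: less_Suc_eq)
qed

lemma dfn_skip1:
  assumes "dfn (\<lambda>e. R (skip n 1 e) (e n))" "\<And>i. dterm (\<lambda>e. q i e)" "dterm t"
  shows "dfn (\<lambda>e. R (\<lambda>i. q i e) (t e))"
proof -
  define r where "r i = (if i < n then q i else if i = n then t else q (i - 1))" for i
  have r: "dterm (r i)" for i
    using assms(2,3) by (simp add: r_def)
  have "skip n 1 (\<lambda>i. r i e) = (\<lambda>i. q i e)" for e
    by (auto simp: skip_def r_def)
  with dfn_subst[OF assms(1), of r, OF r] show ?thesis
    by (simp add: r_def)
qed

lemma dfn_skip2:
  assumes "dfn (\<lambda>e. R (skip n 2 e) (e n) (e (n + 1)))" "\<And>i. dterm (\<lambda>e. q i e)" "dterm t" "dterm s"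
  shows "dfn (\<lambda>e. R (\<lambda>i. q i e) (t e) (s e))"
proof -
  define r where "r i = (if i < n then q i else if i = n then t else if i = n + 1 then s else q (i - 2))" for i
  have r: "dterm (r i)" for i
    using assms(2-4) by (simp add: r_def)
  have "skip n 2 (\<lambda>i. r i e) = (\<lambda>i. q i e)" for e
    by (auto simp: skip_def r_def)
  with dfn_subst[OF assms(1), of r, OF r] show ?thesis
    by (simp add: r_def)
qed

end

section \<open>Local factorization\<close>

lemma (in C_minimal_expansion) local_factorization:
  fixes X :: "(('k, 'g) point \<times> 'k) set" and f :: "('k, 'g) point \<Rightarrow> 'k \<Rightarrow> 'k"
  assumes f: "definable_family_of_functions v L M n m W X f"
    and iso: "\<And>w. w \<in> W \<Longrightarrow> local_C_isomorphism v (X `` {w}) (f w)"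
  shows "\<exists>Y h F. definable_family_of_VG_functions v L M n m X Y h \<and>
    F \<subseteq> X \<and> definable_subset_family v L M n m F \<and>
    (\<forall>w\<in>W. finite (F `` {w}) \<and> locally_factorizes v (X `` {w} - F `` {w}) (f w) (h w))"
proof -
  \<comment> \<open>Outside \<open>X\<close> the default value is \<open>0\<close>, so quantifiers
    can range over the whole field. \<open>PX\<close> and \<open>kP\<close> are membership in
    \<open>X\<close> and the function \<open>k\<close>, read off a code \<open>p\<close> of
    \<open>w\<close>.\<close>
  define k where "k w x = (if (w, x) \<in> X then f w x else 0)" for w x
  define PX where "PX p x \<longleftrightarrow> valid n m p \<and> (point n m p, x) \<in> X" for p x
  define kP where "kP p x = (if PX p x then f (point n m p) x else 0)" for p x
  have kP: "kP p x = k (point n m p) x" if "valid n m p" for p x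
    using that by (simp add: kP_def k_def PX_def)
  have X: "definable v L M (n + 1) m {add_K w x | w x. (w, x) \<in> X}" and W: "fst ` X = W"
    and graph: "definable v L M (n + 2) m {add_K (add_K w x) (f w x) | w x. (w, x) \<in> X}"
    using f by (auto simp: definable_family_of_functions_def definable_family_def definable_subset_family_def)
  have len: "length (fst w) = n" "length (snd w) = m" if "(w, x) \<in> X" for w x
  proof -
    have "\<forall>y\<in>{add_K w x | w x. (w, x) \<in> X}. length (fst y) = n + 1 \<and> length (snd y) = m"
      using X unfolding definable_def by (simp add: case_prod_unfold)
    then have "length (fst (add_K w x)) = n + 1 \<and> length (snd (add_K w x)) = m"
      using that by blast
    then show "length (fst w) = n" "length (snd w) = m"
      by (cases w; simp)+
  qed
  have dfn_PX: "dfn (\<lambda>e. PX (\<lambda>i. q i e) (t e))" if "\<And>i. dterm (\<lambda>e. q i e)" "dterm t" for q t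
  proof (rule dfn_skip1[where R = PX, OF _ that])
    show "dfn (\<lambda>e. PX (skip n 1 e) (e n))"
      using X unfolding definable_iff coded_add_K[abs_def] PX_def by blast
  qed
  have dterm_kP: "dterm (\<lambda>e. kP (\<lambda>i. q i e) (t e))" if q: "\<And>i. dterm (\<lambda>e. q i e)" and t: "dterm t" for q t
  proof -
    define PF where "PF p x y \<longleftrightarrow> PX p x \<and> y = f (point n m p) x" for p x y
    have "{add_K (add_K w x) (f w x) | w x. (w, x) \<in> X} =
        {add_K (add_K w x) y | w x y. (w, x) \<in> X \<and> y = f w x}"
      by blast
    with graph have "definable v L M (n + 2) m {add_K (add_K w x) y | w x y. (w, x) \<in> X \<and> y = f w x}"
      by simp
    then have PF: "dfn (\<lambda>e. PF (skip n 2 e) (e n) (e (n + 1)))"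
      unfolding definable_iff coded_add_K_add_K[abs_def] PF_def PX_def by simp
    have "dfn (\<lambda>e. PF (\<lambda>i. q i (\<lambda>i. e (Suc i))) (t (\<lambda>i. e (Suc i))) (e 0))"
      by (rule dfn_skip2[where R = PF, OF PF]) (rule dterm_shift[OF q] dterm_shift[OF t] dterm_var)+
    moreover have "dfn (\<lambda>e. \<not> PX (\<lambda>i. q i (\<lambda>i. e (Suc i))) (t (\<lambda>i. e (Suc i))))"
      by (intro dfn_not dfn_PX dterm_shift[OF q] dterm_shift[OF t])
    ultimately have "dfn (\<lambda>e. PF (\<lambda>i. q i (\<lambda>i. e (Suc i))) (t (\<lambda>i. e (Suc i))) (e 0) \<or>
        \<not> PX (\<lambda>i. q i (\<lambda>i. e (Suc i))) (t (\<lambda>i. e (Suc i))) \<and> e 0 = 0)"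
      by (intro dfn_disj dfn_conj dfn_eq dterm_var dterm_const)
    moreover have "PF p x y \<or> \<not> PX p x \<and> y = 0 \<longleftrightarrow> y = kP p x" for p x y
      by (auto simp: PF_def kP_def)
    ultimately show ?thesis
      unfolding dterm_def by simp
  qed
  note dfn_rules = dfn_ex dfn_all dfn_conj dfn_imp dfn_not dfn_vless dfn_veq dfn_eq dfn_PX
    dterm_kP dterm_minus dterm_const dterm_var

  \<comment> \<open>A good point has a neighbourhood on which \<open>f w\<close> is injective and
    factorizes over the value group. No function on values is mentioned, so the condition is
    first-order; \<open>goodP\<close> is its form on codes.\<close>
  define good where "good w x \<longleftrightarrow> (w, x) \<in> X \<and> (\<exists>c. c \<noteq> 0 \<and> (\<forall>y. v c < v (y - x) \<longrightarrow> (w, y) \<in> X) \<and>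
    (\<forall>y z. v c < v (y - x) \<and> v c < v (z - x) \<and> y \<noteq> z \<longrightarrow> k w y \<noteq> k w z) \<and>
    (\<forall>y z y' z'. v c < v (y - x) \<and> v c < v (z - x) \<and> v c < v (y' - x) \<and> v c < v (z' - x) \<and>
      v (y - z) = v (y' - z') \<longrightarrow> v (k w y - k w z) = v (k w y' - k w z')))" for w x
  define goodP where "goodP p x \<longleftrightarrow> PX p x \<and> (\<exists>c. c \<noteq> 0 \<and> (\<forall>y. v c < v (y - x) \<longrightarrow> PX p y) \<and>
    (\<forall>y z. v c < v (y - x) \<and> v c < v (z - x) \<and> y \<noteq> z \<longrightarrow> kP p y \<noteq> kP p z) \<and>
    (\<forall>y z y' z'. v c < v (y - x) \<and> v c < v (z - x) \<and> v c < v (y' - x) \<and> v c < v (z' - x) \<and>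
      v (y - z) = v (y' - z') \<longrightarrow> v (kP p y - kP p z) = v (kP p y' - kP p z')))" for p x
  have goodP: "goodP p x \<longleftrightarrow> valid n m p \<and> good (point n m p) x" for p x
  proof (cases "valid n m p")
    case True
    then show ?thesis
      by (simp add: goodP_def good_def kP PX_def)
  qed (simp add: goodP_def PX_def)
  define F where "F = {(w, x) \<in> X. \<not> good w x}"
  have dfn_F: "dfn (\<lambda>e. PX (skip n 1 e) (e n) \<and> \<not> goodP (skip n 1 e) (e n))"
    unfolding goodP_def skip_def[abs_def] by (intro dfn_rules)
  have "definable v L M (n + 1) m {add_K w x | w x. (w, x) \<in> F}"
    unfolding definable_iff
  proof
    show "\<forall>(a, g)\<in>{add_K w x | w x. (w, x) \<in> F}. length a = n + 1 \<and> length g = m"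
      using len by (fastforce simp: F_def)
    have "coded (n + 1) m {add_K w x | w x. (w, x) \<in> F} e \<longleftrightarrow>
        PX (skip n 1 e) (e n) \<and> \<not> goodP (skip n 1 e) (e n)" for e
      unfolding coded_add_K by (auto simp: F_def goodP PX_def)
    with dfn_F show "dfn (coded (n + 1) m {add_K w x | w x. (w, x) \<in> F})"
      by presburger
  qed
  then have F: "definable_subset_family v L M n m F"
    by (simp add: definable_subset_family_def)

  \<comment> \<open>The graph of \<open>h\<close>: a value is assigned at \<open>\<gamma>\<close>
    when all points of the fiber at distance \<open>\<gamma>\<close> from \<open>x\<close> have
    images at the same distance from the image of \<open>x\<close>. Requiring such a point to exist
    makes the value unique.\<close>
  define H where "H w x \<gamma> \<delta> \<longleftrightarrow> (w, x) \<in> X \<and> (\<exists>y. (w, y) \<in> X \<and> v (x - y) = Fin \<gamma>) \<and>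
    (\<forall>y. (w, y) \<in> X \<and> v (x - y) = Fin \<gamma> \<longrightarrow> v (k w x - k w y) = Fin \<delta>)" for w x \<gamma> \<delta>
  define HP where "HP p x c d \<longleftrightarrow> c \<noteq> 0 \<and> d \<noteq> 0 \<and> PX p x \<and> (\<exists>y. PX p y \<and> v (x - y) = v c) \<and>
    (\<forall>y. PX p y \<and> v (x - y) = v c \<longrightarrow> v (kP p x - kP p y) = v d)" for p x c d
  have HP: "HP p x c d \<longleftrightarrow> c \<noteq> 0 \<and> d \<noteq> 0 \<and> valid n m p \<and> H (point n m p) x (val c) (val d)" for p x c d
  proof (cases "valid n m p \<and> c \<noteq> 0 \<and> d \<noteq> 0")
    case True
    then show ?thesis
      by (simp add: HP_def H_def kP PX_def Fin_val)
  qed (auto simp: HP_def PX_def)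
  have H_unique: "\<delta> = \<epsilon>" if "H w x \<gamma> \<delta>" "H w x \<gamma> \<epsilon>" for w x \<gamma> \<delta> \<epsilon>
    using that unfolding H_def by (metis extended.inject)
  have H_X: "(w, x) \<in> X" if "H w x \<gamma> \<delta>" for w x \<gamma> \<delta>
    using that by (simp add: H_def)
  define h where "h w x \<gamma> = (if \<exists>\<delta>. H w x \<gamma> \<delta> then Some (THE \<delta>. H w x \<gamma> \<delta>) else None)" for w x \<gamma>
  have h: "h w x \<gamma> = Some \<delta> \<longleftrightarrow> H w x \<gamma> \<delta>" for w x \<gamma> \<delta>
  proof -
    have "(THE \<delta>. H w x \<gamma> \<delta>) = \<delta>" if "H w x \<gamma> \<delta>" for \<delta>
      using that H_unique by blast
    then show ?thesis
      by (auto simp: h_def)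
  qed
  have h_None: "h w x \<gamma> \<noteq> None \<longleftrightarrow> (\<exists>\<delta>. H w x \<gamma> \<delta>)" for w x \<gamma>
    by (simp add: h_def)
  define Y where "Y = {((w, x), \<gamma>) | w x \<gamma>. h w x \<gamma> \<noteq> None}"
  have Y_iff: "((w, x), \<gamma>) \<in> Y \<longleftrightarrow> (\<exists>\<delta>. H w x \<gamma> \<delta>)" for w x \<gamma>
    unfolding h_None[symmetric] Y_def by blast
  have ball: "\<exists>B. x \<in> B \<and> B \<subseteq> X `` {w} \<and> C_preserving B (k w) \<and> (\<exists>c. c \<noteq> 0 \<and> (\<forall>y. v c \<le> v (y - x) \<longrightarrow> y \<in> B))"
    if x: "(w, x) \<in> X" for w x
  proof -
    have "w \<in> W"
      using x W by force
    from iso[OF this] x obtain B where B: "B \<in> open_balls v" "x \<in> B" "B \<subseteq> X `` {w}" "C_isomorphism v B (f w)"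
      unfolding local_C_isomorphism_def by blast
    obtain a \<rho> where \<rho>: "B = {y. v (y - a) > \<rho>}" "\<rho> \<noteq> \<infinity>"
      using B(1) unfolding open_balls_def by blast
    \<comment> \<open>A value strictly above \<open>\<rho>\<close> places the closed ball of radius
      \<open>v c\<close> around \<open>x\<close> inside \<open>B\<close>.\<close>
    obtain c where c: "c \<noteq> 0" "\<rho> < v c"
      using v_greater[OF \<rho>(2)] by blast
    have "y \<in> B" if "v c \<le> v (y - x)" for y
    proof -
      have "\<rho> < v (y - x)"
        using c(2) that by (rule less_le_trans)
      then have "\<rho> < v (y - a)"
        by (rule v_trans_less) (use B(2) \<rho>(1) in simp)
      then show ?thesis
        by (simp add: \<rho>(1))
    qed
    moreover have "C_preserving B (f w)"
      using B(4) by (simp add: C_isomorphism_def C_preserving_def)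
    then have "C_preserving B (k w)"
      by (rule C_preserving_cong) (use B(3) in \<open>auto simp: k_def\<close>)
    ultimately show ?thesis
      using B(2,3) c(1) by blast
  qed

  \<comment> \<open>Definability of the functions on the value group\<close>
  have "definable_family_of_VG_functions v L M n m X Y h"
    unfolding definable_family_of_VG_functions_def
  proof (intro conjI)
    \<comment> \<open>At \<open>\<gamma> = v c\<close> the whole sphere around \<open>x\<close> lies
      in \<open>B\<close> and contains \<open>x + c\<close>; by \<open>C_preserving_dist\<close> all
      its points have images equally distant from that of \<open>x\<close>.\<close>
    have "\<exists>\<gamma> \<delta>. H w x \<gamma> \<delta>" if x: "(w, x) \<in> X" for w x
    proof -
      obtain B c where B: "x \<in> B" "B \<subseteq> X `` {w}" "C_preserving B (k w)"
        "c \<noteq> 0" "\<And>y. v c \<le> v (y - x) \<Longrightarrow> y \<in> B"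
        using ball[OF x] by blast
      have xc: "x + c \<in> B"
        by (rule B(5)) simp
      have "k w x \<noteq> k w (x + c)"
        using B(4) by (intro C_preserving_inj[OF B(3,1) xc]) simp
      then obtain \<delta> where \<delta>: "v (k w x - k w (x + c)) = Fin \<delta>"
        by (cases "k w x - k w (x + c)" rule: v_cases) auto
      have "H w x (val c) \<delta>"
        unfolding H_def
      proof (intro conjI x exI allI impI)
        show "(w, x + c) \<in> X" "v (x - (x + c)) = Fin (val c)"
          using xc B(2) Fin_val[OF B(4)] by auto
        fix y assume y: "(w, y) \<in> X \<and> v (x - y) = Fin (val c)"
        then have "v (x - y) = v (x - (x + c))"
          using Fin_val[OF B(4)] by simp
        moreover have "y \<in> B"
          using y Fin_val[OF B(4)] by (intro B(5)) (simp add: v_minus_commute)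
        ultimately show "v (k w x - k w y) = Fin \<delta>"
          using C_preserving_dist[OF B(3,1) _ xc] \<delta> by simp
      qed
      then show ?thesis
        by blast
    qed
    note ex = this
    show "fst ` Y = X"
    proof (intro equalityI subrelI)
      fix w x assume "(w, x) \<in> fst ` Y"
      then obtain \<gamma> where "((w, x), \<gamma>) \<in> Y"
        by auto
      then show "(w, x) \<in> X"
        unfolding Y_iff by (elim exE) (rule H_X)
    next
      fix w x assume "(w, x) \<in> X"
      from ex[OF this] obtain \<gamma> where "((w, x), \<gamma>) \<in> Y"
        unfolding Y_iff by blast
      then show "(w, x) \<in> fst ` Y"
        by (intro image_eqI[of _ _ "((w, x), \<gamma>)"]) simp_all
    qed
    have Y: "{add_VG (add_K w x) \<gamma> | w x \<gamma>. ((w, x), \<gamma>) \<in> Y} =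
        {add_VG wx \<gamma> | wx \<gamma>. wx \<in> {add_K w x | w x. \<exists>\<delta>. H w x \<gamma> \<delta>}}"
      unfolding Y_iff by blast
    show "definable v L M (n + 1) (m + 1) {add_VG (add_K w x) \<gamma> | w x \<gamma>. ((w, x), \<gamma>) \<in> Y}"
      unfolding definable_iff
    proof
      show "\<forall>(a, g)\<in>{add_VG (add_K w x) \<gamma> | w x \<gamma>. ((w, x), \<gamma>) \<in> Y}. length a = n + 1 \<and> length g = m + 1"
      proof
        fix y assume "y \<in> {add_VG (add_K w x) \<gamma> | w x \<gamma>. ((w, x), \<gamma>) \<in> Y}"
        then obtain w x \<gamma> where y: "y = add_VG (add_K w x) \<gamma>" "(w, x) \<in> X"
          unfolding Y_iff using H_X by blast
        show "case y of (a, g) \<Rightarrow> length a = n + 1 \<and> length g = m + 1"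
          unfolding y(1) using len[OF y(2)] by (cases w) simp
      qed
      have "coded (n + 1) (m + 1) {add_VG (add_K w x) \<gamma> | w x \<gamma>. ((w, x), \<gamma>) \<in> Y} e \<longleftrightarrow>
          (\<exists>d. HP (skip n 1 e) (e n) (e (n + 1 + m)) d)" for e
      proof -
        \<comment> \<open>A quantifier over values becomes one over nonzero field elements.\<close>
        have "(\<exists>\<delta>. H w x \<gamma> \<delta>) \<longleftrightarrow> (\<exists>d. d \<noteq> 0 \<and> H w x \<gamma> (val d))" for w x \<gamma>
          using v_onto val_eq by (metis extended.distinct(1) v_simps(1))
        then show ?thesis
          unfolding Y coded_add_VG coded_add_K mem_Collect_eq Collect_mem_eq HP by blast
      qed
      moreover have "dfn (\<lambda>e. \<exists>d. HP (skip n 1 e) (e n) (e (n + 1 + m)) d)"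
        unfolding HP_def skip_def[abs_def] by (intro dfn_rules)
      ultimately show "dfn (coded (n + 1) (m + 1) {add_VG (add_K w x) \<gamma> | w x \<gamma>. ((w, x), \<gamma>) \<in> Y})"
        by presburger
    qed
    have G: "{add_VG (add_VG (add_K w x) \<gamma>) \<delta> | w x \<gamma> \<delta>. h w x \<gamma> = Some \<delta>} =
        {add_VG wx\<gamma> \<delta> | wx\<gamma> \<delta>. wx\<gamma> \<in> {add_VG wx \<gamma> | wx \<gamma>. wx \<in> {add_K w x | w x. H w x \<gamma> \<delta>}}}"
      unfolding h by blast
    show "definable v L M (n + 1) (m + 2) {add_VG (add_VG (add_K w x) \<gamma>) \<delta> | w x \<gamma> \<delta>. h w x \<gamma> = Some \<delta>}"
      unfolding definable_iff
    proof
      show "\<forall>(a, g)\<in>{add_VG (add_VG (add_K w x) \<gamma>) \<delta> | w x \<gamma> \<delta>. h w x \<gamma> = Some \<delta>}.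
          length a = n + 1 \<and> length g = m + 2"
      proof
        fix y assume "y \<in> {add_VG (add_VG (add_K w x) \<gamma>) \<delta> | w x \<gamma> \<delta>. h w x \<gamma> = Some \<delta>}"
        then obtain w x \<gamma> \<delta> where y: "y = add_VG (add_VG (add_K w x) \<gamma>) \<delta>" "(w, x) \<in> X"
          unfolding h using H_X by blast
        show "case y of (a, g) \<Rightarrow> length a = n + 1 \<and> length g = m + 2"
          unfolding y(1) using len[OF y(2)] by (cases w) simp
      qed
      have m2: "m + 2 = m + 1 + 1"
        by simp
      have "coded (n + 1) (m + 2) {add_VG (add_VG (add_K w x) \<gamma>) \<delta> | w x \<gamma> \<delta>. h w x \<gamma> = Some \<delta>} e \<longleftrightarrow>
          HP (skip n 1 e) (e n) (e (n + 1 + m)) (e (n + 1 + (m + 1)))" for e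
        unfolding G m2 coded_add_VG coded_add_K mem_Collect_eq Collect_mem_eq HP by blast
      moreover have "dfn (\<lambda>e. HP (skip n 1 e) (e n) (e (n + 1 + m)) (e (n + 1 + (m + 1))))"
        unfolding HP_def skip_def[abs_def] by (intro dfn_rules)
      ultimately show "dfn (coded (n + 1) (m + 2)
          {add_VG (add_VG (add_K w x) \<gamma>) \<delta> | w x \<gamma> \<delta>. h w x \<gamma> = Some \<delta>})"
        by presburger
    qed
  qed (simp add: Y_def)

  \<comment> \<open>Finiteness of the exceptional set\<close>
  moreover have "finite (F `` {w})" if "w \<in> W" for w
  proof (rule ccontr)
    assume inf: "\<not> ?thesis"
    obtain x0 where "(w, x0) \<in> X"
      using \<open>w \<in> W\<close> W by force
    then obtain p where p: "valid n m p" "point n m p = w"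
      using ex_code len by metis
    have Fw: "F `` {w} = {x. PX p x \<and> \<not> goodP p x}"
      using p by (auto simp: F_def PX_def goodP)
    have "dfn (\<lambda>e. PX p (e 0) \<and> \<not> goodP p (e 0))"
      by (rule dfn_skip1[where R = "\<lambda>p x. PX p x \<and> \<not> goodP p x", OF dfn_F]) (intro dterm_const dterm_var)+
    from dfn_locally_constant[OF this, folded Fw] inf obtain x c where c: "x \<in> F `` {w}" "c \<noteq> 0"
      "\<And>y. v c < v (y - x) \<Longrightarrow> y \<in> F `` {w}"
      unfolding locally_constant_off_finite_def by (meson finite_subset subsetI)
    have "(w, x) \<in> X"
      using c(1) by (simp add: F_def)
    from ball[OF this] obtain B c' where B: "B \<subseteq> X `` {w}" "C_preserving B (k w)" "c' \<noteq> 0"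
      "\<And>y. v c' \<le> v (y - x) \<Longrightarrow> y \<in> B"
      by blast
    \<comment> \<open>The radius of \<open>D\<close> exceeds those of both balls, so the closed ball
      \<open>D\<close> around \<open>x\<close> lies in \<open>B\<close> and in the fiber of
      \<open>F\<close>.\<close>
    obtain b where b: "b \<noteq> 0" "max (v c) (v c') < v b"
      by (rule v_greater[of "max (v c) (v c')"]) (use c(2) B(3) in \<open>auto simp: max_def\<close>)
    define D where "D = {y. v b \<le> v (y - x)}"
    have DB: "D \<subseteq> B" and DF: "D \<subseteq> F `` {w}"
      using b(2) B(4) c(3) by (force simp: D_def)+
    have kw: "kP p = k w"
      using kP[OF p(1)] p(2) by auto
    have "dterm (\<lambda>e. k w (e 0))"
      unfolding kw[symmetric] by (intro dterm_kP dterm_const dterm_var)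
    from exists_factorizing_cone[OF D_def b(1) C_preserving_subset[OF B(2) DB] this]
    obtain y where y: "y \<in> D" "\<forall>z1 z2 z3 z4. v b < v (z1 - y) \<and> v b < v (z2 - y) \<and> v b < v (z3 - y) \<and>
      v b < v (z4 - y) \<and> v (z1 - z2) = v (z3 - z4) \<longrightarrow> v (k w z1 - k w z2) = v (k w z3 - k w z4)"
      by blast
    have cone: "z \<in> D" if "v b < v (z - y)" for z
      using v_trans_le[of "v b" z y x] that y(1) by (simp add: D_def)
    \<comment> \<open>The cone of \<open>y\<close> in \<open>D\<close> witnesses goodness, while
      \<open>y\<close>, as a point of \<open>D\<close>, belongs to the fiber of
      \<open>F\<close>.\<close>
    have "good w y"
      unfolding good_def
    proof (intro conjI exI)
      show "(w, y) \<in> X" "b \<noteq> 0" "\<forall>z. v b < v (z - y) \<longrightarrow> (w, z) \<in> X"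
        using y(1) b(1) cone DB B(1) by blast+
      show "\<forall>z1 z2. v b < v (z1 - y) \<and> v b < v (z2 - y) \<and> z1 \<noteq> z2 \<longrightarrow> k w z1 \<noteq> k w z2"
        using C_preserving_inj[OF B(2)] cone DB by blast
    qed (fact y(2))
    then show False
      using y(1) DF by (auto simp: F_def)
  qed

  \<comment> \<open>Local factorization off the exceptional set\<close>
  moreover have "locally_factorizes v (X `` {w} - F `` {w}) (f w) (h w)" for w
    unfolding locally_factorizes_def
  proof
    fix x assume "x \<in> X `` {w} - F `` {w}"
    then have "good w x"
      by (simp add: F_def)
    then obtain c where x: "(w, x) \<in> X" and c: "c \<noteq> 0" "\<And>y. v c < v (y - x) \<Longrightarrow> (w, y) \<in> X"
      "\<And>y z. v c < v (y - x) \<Longrightarrow> v c < v (z - x) \<Longrightarrow> y \<noteq> z \<Longrightarrow> k w y \<noteq> k w z"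
      "\<And>y z y' z'. v c < v (y - x) \<Longrightarrow> v c < v (z - x) \<Longrightarrow> v c < v (y' - x) \<Longrightarrow> v c < v (z' - x) \<Longrightarrow>
        v (y - z) = v (y' - z') \<Longrightarrow> v (k w y - k w z) = v (k w y' - k w z')"
      unfolding good_def by blast
    define B where "B = {y. v (y - x) > v c}"
    have B: "B \<in> open_balls v"
      using c(1) unfolding open_balls_def B_def by (intro CollectI exI[of _ x] exI[of _ "v c"]) simp
    have xB: "x \<in> B"
      using c(1) by (cases c rule: v_cases) (auto simp: B_def)
    \<comment> \<open>Every point of an open ball is a centre, so the same \<open>c\<close> makes
      all points of \<open>B\<close> good and keeps \<open>B\<close> away from
      \<open>F\<close>.\<close>
    have recenter: "v c < v (z - y) \<longleftrightarrow> v c < v (z - x)" if "y \<in> B" for y z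
      using that v_trans_less[of "v c" z y x] v_trans_less[of "v c" z x y]
      by (auto simp: B_def v_minus_commute[of x y])
    have "good w y" if "y \<in> B" for y
      unfolding good_def
    proof (intro conjI exI[of _ c])
      show "(w, y) \<in> X"
        using that c(2) by (simp add: B_def)
    qed (use c in \<open>auto simp: recenter[OF that]\<close>)
    then have "B \<subseteq> X `` {w} - F `` {w}"
      using c(2) by (auto simp: F_def B_def)
    moreover have "factorizes v B (f w) (h w x)"
      unfolding factorizes_def
    proof (intro ballI impI)
      fix y z assume yz: "y \<in> B" "z \<in> B" "y \<noteq> z"
      then obtain \<gamma> where \<gamma>: "v (y - z) = Fin \<gamma>"
        by (cases "y - z" rule: v_cases) auto
      have kf: "k w y = f w y" "k w z = f w z"
        using yz(1,2) c(2) by (simp_all add: k_def B_def)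
      obtain \<delta> where \<delta>: "v (k w y - k w z) = Fin \<delta>"
        using c(3)[of y z] yz by (cases "k w y - k w z" rule: v_cases) (auto simp: B_def)
      have "v c < v (y - z)"
        using yz(1) recenter[OF yz(2)] by (simp add: B_def)
      have in_B: "y' \<in> B" if "v (x - y') = Fin \<gamma>" for y'
        using that \<open>v c < v (y - z)\<close> \<gamma> by (simp add: B_def v_minus_commute)
      \<comment> \<open>As \<open>v c < Fin \<gamma>\<close>, the sphere of radius
        \<open>\<gamma>\<close> around \<open>x\<close> lies in \<open>B\<close>, and goodness
        compares each of its points with the pair \<open>y\<close>, \<open>z\<close>. Translating
        the difference \<open>y - z\<close> to \<open>x\<close> gives a point of the sphere.\<close>
      have "H w x \<gamma> \<delta>"
        unfolding H_def
      proof (intro conjI x exI allI impI)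
        show "v (x - (x - (y - z))) = Fin \<gamma>"
          using \<gamma> by simp
        from in_B[OF this] show "(w, x - (y - z)) \<in> X"
          using c(2) by (simp add: B_def)
        fix y' assume "(w, y') \<in> X \<and> v (x - y') = Fin \<gamma>"
        then have "v (k w x - k w y') = v (k w y - k w z)"
          using xB yz in_B[of y'] \<gamma> by (intro c(4)) (simp_all add: B_def)
        then show "v (k w x - k w y') = Fin \<delta>"
          by (simp add: \<delta>)
      qed
      then show "\<exists>\<gamma> \<delta>. v (y - z) = Fin \<gamma> \<and> h w x \<gamma> = Some \<delta> \<and> v (f w y - f w z) = Fin \<delta>"
        using \<gamma> \<delta> by (auto simp: h kf)
    qed
    ultimately show "\<exists>B\<in>open_balls v. x \<in> B \<and> B \<subseteq> X `` {w} - F `` {w} \<and> factorizes v B (f w) (h w x)"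
      using B xB by blast
  qed
  moreover have "F \<subseteq> X"
    by (auto simp: F_def)
  ultimately show ?thesis
    using F by blast
qed

theorem theorem3p8:
  fixes v :: "'k::alg_closed_field \<Rightarrow> 'g::linordered_ab_group_add extended"
    and L :: "('f vf_fun, 'r vf_rel) signature"
    and M :: "('f vf_fun, 'r vf_rel, 'k) fo_structure"
    and n m :: nat
    and W :: "('k, 'g) point set"
    and X :: "(('k, 'g) point \<times> 'k) set"
    and f :: "('k, 'g) point \<Rightarrow> 'k \<Rightarrow> 'k"
  assumes "expansion_of_valued_field v L M"
    and "C_minimal L M"
    and "definable v L M n m W"
    and "definable_family_of_functions v L M n m W X f"
    and "\<And>w. w \<in> W \<Longrightarrow> local_C_isomorphism v (X `` {w}) (f w)"
  shows "\<exists>Y h F.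
    definable_family_of_VG_functions v L M n m X Y h \<and>
    F \<subseteq> X \<and> definable_subset_family v L M n m F \<and>
    (\<forall>w\<in>W. finite (F `` {w}) \<and>
       locally_factorizes v (X `` {w} - F `` {w}) (f w) (h w))"
proof -
  interpret C_minimal_expansion v L M
    by unfold_locales (fact assms)+
  show ?thesis
    by (rule local_factorization) (fact assms)+
qed

end
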